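(* Let $\mathcal{M}$ and $\mathcal{N}$ be quantum metric spaces. (a) If $\mathcal{N}$ is a metric quotient of $\mathcal{M}$, then $\operatorname{asdim}(\mathcal{N}) \le \operatorname{asdim}(\mathcal{M})$. (b) $\operatorname{asdim}( \mathcal{M} \oplus \mathcal{N} ) = \max \{ \operatorname{asdim}(\mathcal{M}), \operatorname{asdim}(\mathcal{N}) \}$, where $\mathcal{M}\oplus\mathcal{N}$ is the direct sum of quantum metric spaces.
   Context: Von Neumann algebras are concrete: $\mathcal{M}\subseteq\mathcal{B}(\mathcal{H})$, with commutant $\mathcal{M}'$; "projection" means orthogonal projection; $\mathcal{M}\overline{\otimes}\mathcal{B}(\ell_2)$ is the weak*-closed spatial tensor product in $\mathcal{B}(\mathcal{H}\otimes_2\ell_2)$. $\inf\emptyset=\infty$. A quantum metric on $\mathcal{M}\subseteq \mathcal{B}(\mathcal{H})$ is a family $\mathbb{V}=\{\mathcal{V}_t\}_{t\in[0,\infty)}$ of weak*-closed self-adjoint subspaces of $\mathcal{B}(\mathcal{H})$ with $\mathcal{V}_0=\mathcal{M}'$, $\mathcal{V}_s\mathcal{V}_t\subseteq \mathcal{V}_{s+t}$ for all $s,t\ge 0$, and $\mathcal{V}_t=\bigcap_{s>t}\mathcal{V}_s$ for all $t\ge0$. A quantum metric space is a pair $(\mathcal{M},\mathbb{V})$. For projections $P,Q\in\mathcal{M}\overline{\otimes}\mathcal{B}(\ell_2)$, $\operatorname{dist}(P,Q)=\inf\{t \mid P(A\otimes \mathrm{Id})Q\ne0 \text{ for some } A\in\mathcal{V}_t\}$;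 for $P,Q\in\mathcal{M}$ (identified with $P\otimes\mathrm{Id}$, $Q\otimes \mathrm{Id}$) this is $\inf\{t\mid PAQ\neq0\text{ for some }A\in\mathcal{V}_t\}$. For a nonzero projection $P\in\mathcal{M}$, $\operatorname{diam}(P)=\sup\{\operatorname{dist}(Q,R)\mid Q(PAP\otimes\mathrm{Id})R\ne0\text{ for some }A\in\mathcal{B}(\mathcal{H})\}$, with $Q,R$ ranging over projections in $\mathcal{M}\overline{\otimes}\mathcal{B}(\ell_2)$; $\operatorname{diam}(0)=0$. The open $\varepsilon$-neighborhood of a projection $P\in\mathcal{M}$ is $(P)_\varepsilon=\mathrm{Id}-\bigvee\{Q\in\mathcal{M}\text{ projection}\mid \operatorname{dist}(P,Q)\ge\varepsilon\}$. A family $\mathscr{P}$ of projections in $\mathcal{M}$ is a cover if $\bigvee_{P\in\mathscr{P}}P=\mathrm{Id}$; it is $r$-disjoint if $(P)_r(Q)_r=0$ for all distinct $P,Q\in\mathscr{P}$; it is uniformly bounded if $\sup_{P\in\mathscr{P}}\operatorname{diam}(P)\le R$ for some $R>0$. $\operatorname{asdim}(\mathcal{M})\le n$ ($n\in\mathbb{N}\cup\{0\}$) if for every $r>0$ there are uniformly bounded, $r$-disjoint families $\mathscr{P}^0,\dots,\mathscr{P}^n$ of projections in $\mathcal{M}$ whose union is a cover for $\mathcal{M}$; $\operatorname{asdim}(\mathcal{M})$ is the least such $n$, and $\infty$ if there is none. Metric quotient: given $(\mathcal{M},\{\mathcal{V}_t\})$ with $\mathcal{M}\subseteq\mathcal{B}(\mathcal{H})$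 and a central projection $R\in\mathcal{M}$, the corresponding metric quotient is the direct summand $R\mathcal{M}\subseteq\mathcal{B}(R\mathcal{H})$ with the quantum metric $\{R\mathcal{V}_tR\}_{t\ge0}$ (compressions viewed as operators on $R\mathcal{H}$). Direct sum: for $(\mathcal{M},\{\mathcal{V}_t\})$ and $(\mathcal{N},\{\mathcal{W}_t\})$ with $\mathcal{M}\subseteq\mathcal{B}(\mathcal{H})$, $\mathcal{N}\subseteq\mathcal{B}(\mathcal{K})$, the direct sum is $\mathcal{M}\oplus\mathcal{N}\subseteq\mathcal{B}(\mathcal{H}\oplus\mathcal{K})$ with quantum metric $\{\mathcal{V}_t\oplus\mathcal{W}_t\}_{t\ge0}$ (block-diagonal operators). *)

theory Defs
  imports "HOL-Analysis.Analysis"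
begin

section \<open>Complex Hilbert spaces\<close>

text \<open>
  A complex Hilbert space is its underlying real Hilbert space (with inner product
  \<open>x \<bullet> y = Re \<langle>x, y\<rangle>\<close>), together with the complex scalar multiplication and
  the complex inner product, which is linear in the second argument.
\<close>

class chilbert_space = real_inner + complete_space +
  fixes scaleC :: "complex \<Rightarrow> 'a \<Rightarrow> 'a" (infixr \<open>*\<^sub>C\<close> 75)
    and cinner :: "'a \<Rightarrow> 'a \<Rightarrow> complex"
  assumes scaleC_add_right: "c *\<^sub>C (x + y) = c *\<^sub>C x + c *\<^sub>C y"
    and scaleC_add_left: "(c + d) *\<^sub>C x = c *\<^sub>C x + d *\<^sub>C x"
    and scaleC_scaleC: "c *\<^sub>C d *\<^sub>C x = (c * d) *\<^sub>C x"
    and scaleC_of_real: "complex_of_real r *\<^sub>C x = r *\<^sub>R x"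
    and cinner_commute: "cinner x y = cnj (cinner y x)"
    and cinner_add_right: "cinner x (y + z) = cinner x y + cinner x z"
    and cinner_scaleC_right: "cinner x (c *\<^sub>C y) = c * cinner x y"
    and inner_eq_Re_cinner: "inner x y = Re (cinner x y)"
begin

subclass banach ..

end

lemma cinner_scaleC_left: "cinner (c *\<^sub>C x) y = cnj c * cinner x y"
  by (metis cinner_commute cinner_scaleC_right complex_cnj_mult)

lemma cinner_self: "cinner x x = complex_of_real ((norm x)\<^sup>2)"
proof (rule complex_eqI)
  show "Re (cinner x x) = Re (complex_of_real ((norm x)\<^sup>2))"
    by (simp add: inner_eq_Re_cinner[symmetric] power2_norm_eq_inner)
  have "cinner x x = cnj (cinner x x)"
    by (rule cinner_commute)
  then show "Im (cinner x x) = Im (complex_of_real ((norm x)\<^sup>2))"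
    by (simp add: complex_eq_iff)
qed

lemma norm_scaleC: "norm (c *\<^sub>C x) = cmod c * norm (x :: 'a :: chilbert_space)"
proof -
  have "complex_of_real ((norm (c *\<^sub>C x))\<^sup>2) = complex_of_real ((cmod c * norm x)\<^sup>2)"
    unfolding cinner_self[symmetric] cinner_scaleC_left cinner_scaleC_right
    by (simp only: cinner_self power_mult_distrib of_real_mult complex_norm_square ac_simps)
  then have "(norm (c *\<^sub>C x))\<^sup>2 = (cmod c * norm x)\<^sup>2"
    using of_real_eq_iff by blast
  then show ?thesis
    by (rule power2_eq_imp_eq) auto
qed

lemma scaleC_scaleR: "c *\<^sub>C (r *\<^sub>R x) = r *\<^sub>R (c *\<^sub>C (x :: 'a :: chilbert_space))"
  by (simp add: scaleC_of_real[symmetric] scaleC_scaleC mult.commute)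

lemma bounded_linear_scaleC: "bounded_linear (\<lambda>x :: 'a :: chilbert_space. c *\<^sub>C x)"
  by (rule bounded_linear_intro[where K = "cmod c"])
    (simp_all add: scaleC_add_right scaleC_scaleR norm_scaleC)

instantiation complex :: chilbert_space
begin

definition scaleC_complex_def: "c *\<^sub>C x = c * (x :: complex)"
definition cinner_complex_def: "cinner x y = cnj x * (y :: complex)"

instance
  by standard
    (auto simp: scaleC_complex_def cinner_complex_def inner_complex_def algebra_simps
      scaleR_conv_of_real)

end

instantiation prod :: (chilbert_space, chilbert_space) chilbert_space
begin

definition scaleC_prod_def: "c *\<^sub>C x = (c *\<^sub>C fst x, c *\<^sub>C snd x)"
definition cinner_prod_def: "cinner x y = cinner (fst x) (fst y) + cinner (snd x) (snd y)"

instance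
proof
  fix x y :: "'a \<times> 'b"
  show "cinner x y = cnj (cinner y x)"
    unfolding cinner_prod_def by (metis cinner_commute complex_cnj_add)
qed (auto simp: scaleC_prod_def cinner_prod_def scaleC_add_right scaleC_add_left scaleC_scaleC
      scaleC_of_real cinner_add_right cinner_scaleC_right inner_prod_def inner_eq_Re_cinner
      scaleR_prod_def algebra_simps)

end

section \<open>The Hilbert space tensor product with \<open>\<ell>\<^sub>2\<close>\<close>

text \<open>
  \<open>'h ell2\<close> is the space of square-summable sequences in \<open>'h\<close>. In particular
  \<open>complex ell2\<close> is \<open>\<ell>\<^sub>2\<close>, and \<open>'h ell2\<close> is the Hilbert space tensor product of \<open>'h\<close> with
  \<open>\<ell>\<^sub>2\<close>, the elementary tensor of \<open>h\<close> and \<open>e\<close> being the sequence \<open>n \<mapsto> e n *\<^sub>C h\<close>.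
\<close>

typedef (overloaded) ('h :: real_normed_vector) ell2 =
  "{x :: nat \<Rightarrow> 'h. summable (\<lambda>n. (norm (x n))\<^sup>2)}"
  by (rule exI[of _ "\<lambda>_. 0"]) simp

setup_lifting type_definition_ell2

lemma norm_add_square_le:
  "(norm (x + y))\<^sup>2 \<le> 2 * (norm x)\<^sup>2 + 2 * (norm (y :: 'h :: real_normed_vector))\<^sup>2"
proof -
  have "(norm (x + y))\<^sup>2 \<le> (norm x + norm y)\<^sup>2"
    by (simp add: norm_triangle_ineq power_mono)
  also have "\<dots> \<le> 2 * (norm x)\<^sup>2 + 2 * (norm y)\<^sup>2"
    using sum_squares_bound[of "norm x" "norm y"] by (simp add: power2_sum)
  finally show ?thesis .
qed

lemma summable_add_square:
  fixes x y :: "nat \<Rightarrow> 'h :: real_normed_vector"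
  assumes "summable (\<lambda>n. (norm (x n))\<^sup>2)" "summable (\<lambda>n. (norm (y n))\<^sup>2)"
  shows "summable (\<lambda>n. (norm (x n + y n))\<^sup>2)"
proof (rule summable_comparison_test')
  show "summable (\<lambda>n. 2 * (norm (x n))\<^sup>2 + 2 * (norm (y n))\<^sup>2)"
    by (intro summable_add summable_mult assms)
  show "norm ((norm (x n + y n))\<^sup>2) \<le> 2 * (norm (x n))\<^sup>2 + 2 * (norm (y n))\<^sup>2" if "n \<ge> 0" for n
    using norm_add_square_le[of "x n" "y n"] by simp
qed

lemma summable_dominated_product:
  fixes f :: "nat \<Rightarrow> 'c :: banach"
  assumes "summable (\<lambda>n. (a n)\<^sup>2)" "summable (\<lambda>n. (b n)\<^sup>2)"
    and "\<And>n. norm (f n) \<le> a n * b n"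
  shows "summable f"
proof (rule summable_comparison_test')
  show "summable (\<lambda>n. (a n)\<^sup>2 + (b n)\<^sup>2 :: real)"
    by (intro summable_add assms)
  show "norm (f n) \<le> (a n)\<^sup>2 + (b n)\<^sup>2" if "n \<ge> 0" for n
  proof -
    have "0 \<le> (a n)\<^sup>2 + (b n)\<^sup>2" "2 * (a n * b n) \<le> (a n)\<^sup>2 + (b n)\<^sup>2"
      using sum_squares_bound[of "a n" "b n"] by simp_all
    with assms(3)[of n] norm_ge_zero[of "f n"] show ?thesis by linarith
  qed
qed

lemma cmod_cinner_le: "cmod (cinner x y) \<le> norm x * norm (y :: 'a :: chilbert_space)"
proof -
  define c where "c = cnj (sgn (cinner x y))"
  have "c * cinner x y = complex_of_real (cmod (cinner x y))"
    using complex_norm_square[of "cinner x y"]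
    by (cases "cinner x y = 0") (simp_all add: c_def sgn_eq power2_eq_square field_simps)
  then have "cmod (cinner x y) = Re (cinner x (c *\<^sub>C y))"
    by (simp add: cinner_scaleC_right)
  also have "\<dots> \<le> norm x * norm (c *\<^sub>C y)"
    by (simp add: inner_eq_Re_cinner[symmetric] norm_cauchy_schwarz)
  also have "\<dots> \<le> norm x * norm y"
    by (simp add: c_def norm_scaleC norm_sgn mult_left_mono)
  finally show ?thesis .
qed

lemma summable_inner_ell2:
  "summable (\<lambda>n. inner (Rep_ell2 x n) (Rep_ell2 y n :: 'a :: real_inner))"
  by (rule summable_dominated_product[where a = "\<lambda>n. norm (Rep_ell2 x n)"
        and b = "\<lambda>n. norm (Rep_ell2 y n)"])
    (use Rep_ell2[of x] Rep_ell2[of y] in \<open>simp_all add: Cauchy_Schwarz_ineq2\<close>)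

lemma summable_cinner_ell2:
  "summable (\<lambda>n. cinner (Rep_ell2 x n) (Rep_ell2 y n :: 'a :: chilbert_space))"
  by (rule summable_dominated_product[where a = "\<lambda>n. norm (Rep_ell2 x n)"
        and b = "\<lambda>n. norm (Rep_ell2 y n)"])
    (use Rep_ell2[of x] Rep_ell2[of y] in \<open>simp_all add: cmod_cinner_le\<close>)

instantiation ell2 :: (real_inner) real_inner
begin

lift_definition zero_ell2 :: "'a ell2" is "\<lambda>_. 0" by simp
lift_definition plus_ell2 :: "'a ell2 \<Rightarrow> 'a ell2 \<Rightarrow> 'a ell2" is "\<lambda>x y n. x n + y n"
  by (rule summable_add_square)
lift_definition uminus_ell2 :: "'a ell2 \<Rightarrow> 'a ell2" is "\<lambda>x n. - x n" by simp
lift_definition minus_ell2 :: "'a ell2 \<Rightarrow> 'a ell2 \<Rightarrow> 'a ell2" is "\<lambda>x y n. x n - y n"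
  using summable_add_square[of _ "\<lambda>n. - _ n"] by simp
lift_definition scaleR_ell2 :: "real \<Rightarrow> 'a ell2 \<Rightarrow> 'a ell2" is "\<lambda>r x n. r *\<^sub>R x n"
  by (simp add: power_mult_distrib summable_mult)
lift_definition inner_ell2 :: "'a ell2 \<Rightarrow> 'a ell2 \<Rightarrow> real" is "\<lambda>x y. \<Sum>n. inner (x n) (y n)" .

definition norm_ell2 :: "'a ell2 \<Rightarrow> real" where "norm_ell2 x = sqrt (inner x x)"
definition dist_ell2 :: "'a ell2 \<Rightarrow> 'a ell2 \<Rightarrow> real" where "dist_ell2 x y = norm (x - y)"
definition sgn_ell2 :: "'a ell2 \<Rightarrow> 'a ell2" where "sgn_ell2 x = inverse (norm x) *\<^sub>R x"
definition uniformity_ell2 :: "('a ell2 \<times> 'a ell2) filter" where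
  "uniformity_ell2 = (INF e\<in>{0<..}. principal {(x, y). dist x y < e})"
definition open_ell2 :: "'a ell2 set \<Rightarrow> bool" where
  "open_ell2 U \<longleftrightarrow> (\<forall>x\<in>U. eventually (\<lambda>(x', y). x' = x \<longrightarrow> y \<in> U) uniformity)"

instance
proof
  fix x y z :: "'a ell2" and r s :: real and U :: "'a ell2 set"
  show "x + y + z = x + (y + z)" by transfer (simp add: add.assoc)
  show "x + y = y + x" by transfer (simp add: add.commute)
  show "0 + x = x" by transfer simp
  show "- x + x = 0" by transfer simp
  show "x - y = x + - y" by transfer simp
  show "r *\<^sub>R (x + y) = r *\<^sub>R x + r *\<^sub>R y" by transfer (simp add: scaleR_add_right)
  show "(r + s) *\<^sub>R x = r *\<^sub>R x + s *\<^sub>R x" by transfer (simp add: scaleR_add_left)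
  show "r *\<^sub>R s *\<^sub>R x = (r * s) *\<^sub>R x" by transfer simp
  show "1 *\<^sub>R x = x" by transfer simp
  show "dist x y = norm (x - y)" by (rule dist_ell2_def)
  show "sgn x = inverse (norm x) *\<^sub>R x" by (rule sgn_ell2_def)
  show "uniformity = (INF e\<in>{0<..}. principal {(x, y :: 'a ell2). dist x y < e})"
    by (rule uniformity_ell2_def)
  show "open U \<longleftrightarrow> (\<forall>x\<in>U. eventually (\<lambda>(x', y). x' = x \<longrightarrow> y \<in> U) uniformity)"
    by (rule open_ell2_def)
  show "norm x = sqrt (inner x x)" by (rule norm_ell2_def)
  show "inner x y = inner y x" by transfer (simp add: inner_commute)
  show "inner (x + y) z = inner x z + inner y z"
    using summable_inner_ell2[of x z] summable_inner_ell2[of y z]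
    by (simp add: inner_ell2.rep_eq plus_ell2.rep_eq inner_add_left suminf_add)
  show "inner (r *\<^sub>R x) y = r * inner x y"
    using summable_inner_ell2[of x y]
    by (simp add: inner_ell2.rep_eq scaleR_ell2.rep_eq suminf_mult)
  show "0 \<le> inner x x"
    using summable_inner_ell2[of x x] by (simp add: inner_ell2.rep_eq suminf_nonneg)
  show "(inner x x = 0) = (x = 0)"
    using suminf_eq_zero_iff[OF summable_inner_ell2[of x x]]
    by (simp add: inner_ell2.rep_eq zero_ell2.rep_eq fun_eq_iff Rep_ell2_inject[symmetric])
qed

end

lemma norm_ell2_square: "(norm x)\<^sup>2 = (\<Sum>n. (norm (Rep_ell2 x n :: 'h :: real_inner))\<^sup>2)"
  unfolding power2_norm_eq_inner inner_ell2.rep_eq ..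

instance ell2 :: ("{real_inner, complete_space}") complete_space
proof
  fix X :: "nat \<Rightarrow> 'a ell2"
  assume cau: "Cauchy X"
  have part: "(\<Sum>n<K. (norm (Rep_ell2 x n))\<^sup>2) \<le> (norm x)\<^sup>2" for x :: "'a ell2" and K
    unfolding norm_ell2_square using Rep_ell2[of x] by (intro sum_le_suminf) auto
  have dist2: "dist x y = sqrt (\<Sum>n. (norm (Rep_ell2 x n - Rep_ell2 y n))\<^sup>2)"
    for x y :: "'a ell2"
    using norm_ell2_square[of "x - y"] unfolding minus_ell2.rep_eq
    by (metis dist_norm norm_ge_zero real_sqrt_abs abs_of_nonneg)
  have partd: "(\<Sum>n<K. (norm (Rep_ell2 x n - Rep_ell2 y n))\<^sup>2) \<le> (dist x y)\<^sup>2"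
    for x y :: "'a ell2" and K
    using part[of "x - y" K] by (simp add: minus_ell2.rep_eq dist_ell2_def)
  have coord: "dist (Rep_ell2 x n) (Rep_ell2 y n) \<le> dist x y" for x y :: "'a ell2" and n
  proof (rule power2_le_imp_le)
    have "(dist (Rep_ell2 x n) (Rep_ell2 y n))\<^sup>2
        \<le> (\<Sum>n<Suc n. (norm (Rep_ell2 x n - Rep_ell2 y n))\<^sup>2)"
      unfolding dist_norm by (rule member_le_sum) auto
    with partd[where K = "Suc n" and x = x and y = y]
    show "(dist (Rep_ell2 x n) (Rep_ell2 y n))\<^sup>2 \<le> (dist x y)\<^sup>2" by linarith
    show "0 \<le> dist x y" by simp
  qed
  have cauE: "\<exists>N. \<forall>m\<ge>N. \<forall>k\<ge>N. dist (X m) (X k) < e" if pos: "e > 0" for e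
    using cau that by (simp add: Cauchy_def)
  have "Cauchy (\<lambda>m. Rep_ell2 (X m) n)" for n
    unfolding Cauchy_def using cauE coord by (meson le_less_trans)
  then have "\<exists>l. (\<lambda>m. Rep_ell2 (X m) n) \<longlonglongrightarrow> l" for n
    using Cauchy_convergent_iff convergent_def by blast
  then obtain L where L: "\<And>n. (\<lambda>m. Rep_ell2 (X m) n) \<longlonglongrightarrow> L n"
    by metis
  have bound: "(\<Sum>n<K. (norm (Rep_ell2 (X m) n - L n))\<^sup>2) \<le> e\<^sup>2"
    if N: "\<forall>m\<ge>N. \<forall>k\<ge>N. dist (X m) (X k) < e" and m: "m \<ge> N" for N m e K
  proof (rule tendsto_upperbound)
    show "((\<lambda>k. \<Sum>n<K. (norm (Rep_ell2 (X m) n - Rep_ell2 (X k) n))\<^sup>2)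
        \<longlongrightarrow> (\<Sum>n<K. (norm (Rep_ell2 (X m) n - L n))\<^sup>2)) sequentially"
      by (intro tendsto_intros L)
    have "(\<Sum>n<K. (norm (Rep_ell2 (X m) n - Rep_ell2 (X k) n))\<^sup>2) \<le> e\<^sup>2" if "k \<ge> N" for k
    proof -
      have "(dist (X m) (X k))\<^sup>2 \<le> e\<^sup>2"
        using N m that by (intro power_mono) (auto intro: less_imp_le)
      with partd[where K = K and x = "X m" and y = "X k"] show ?thesis by linarith
    qed
    then show "\<forall>\<^sub>F k in sequentially.
        (\<Sum>n<K. (norm (Rep_ell2 (X m) n - Rep_ell2 (X k) n))\<^sup>2) \<le> e\<^sup>2"
      by (auto simp: eventually_sequentially)
  qed simp
  have summ: "summable (\<lambda>n. (norm (Rep_ell2 (X m) n - L n))\<^sup>2)"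
    and le: "(\<Sum>n. (norm (Rep_ell2 (X m) n - L n))\<^sup>2) \<le> e\<^sup>2"
    if "\<forall>m\<ge>N. \<forall>k\<ge>N. dist (X m) (X k) < e" "m \<ge> N" for N m e
  proof -
    show s: "summable (\<lambda>n. (norm (Rep_ell2 (X m) n - L n))\<^sup>2)"
      by (rule bounded_imp_summable[of _ "e\<^sup>2"])
        (use bound[OF that] in \<open>simp_all only: lessThan_Suc_atMost[symmetric] zero_le_power2\<close>)
    show "(\<Sum>n. (norm (Rep_ell2 (X m) n - L n))\<^sup>2) \<le> e\<^sup>2"
      using bound[OF that] by (intro suminf_le_const[OF s])
  qed
  obtain N1 where N1: "\<forall>m\<ge>N1. \<forall>k\<ge>N1. dist (X m) (X k) < 1"
    using cauE[of 1] by auto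
  have "summable (\<lambda>n. (norm (Rep_ell2 (X N1) n + - (Rep_ell2 (X N1) n - L n)))\<^sup>2)"
    using summ[OF N1 order_refl] Rep_ell2[of "X N1"]
    by (intro summable_add_square) (auto simp: norm_minus_commute)
  then have "summable (\<lambda>n. (norm (L n))\<^sup>2)" by simp
  then have RL: "Rep_ell2 (Abs_ell2 L) = L"
    by (simp add: Abs_ell2_inverse)
  have "\<exists>N. \<forall>m\<ge>N. dist (X m) (Abs_ell2 L) < e" if pos: "e > 0" for e
  proof -
    obtain N where N: "\<forall>m\<ge>N. \<forall>k\<ge>N. dist (X m) (X k) < e / 2"
      using cauE[OF half_gt_zero[OF pos]] by blast
    have "dist (X m) (Abs_ell2 L) < e" if "m \<ge> N" for m
    proof -
      have "dist (X m) (Abs_ell2 L) \<le> sqrt ((e / 2)\<^sup>2)"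
        unfolding dist2 RL using le[OF N that] by (rule real_sqrt_le_mono)
      with \<open>e > 0\<close> show ?thesis by simp
    qed
    then show ?thesis by blast
  qed
  then show "convergent X"
    unfolding convergent_def lim_sequentially by blast
qed

instantiation ell2 :: (chilbert_space) chilbert_space
begin

lift_definition scaleC_ell2 :: "complex \<Rightarrow> 'a ell2 \<Rightarrow> 'a ell2" is "\<lambda>c x n. c *\<^sub>C x n"
  by (simp add: norm_scaleC power_mult_distrib summable_mult)
lift_definition cinner_ell2 :: "'a ell2 \<Rightarrow> 'a ell2 \<Rightarrow> complex" is "\<lambda>x y. \<Sum>n. cinner (x n) (y n)" .

instance
proof
  fix x y z :: "'a ell2" and r :: real and c d :: complex
  show "c *\<^sub>C (x + y) = c *\<^sub>C x + c *\<^sub>C y" by transfer (simp add: scaleC_add_right)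
  show "(c + d) *\<^sub>C x = c *\<^sub>C x + d *\<^sub>C x" by transfer (simp add: scaleC_add_left)
  show "c *\<^sub>C d *\<^sub>C x = (c * d) *\<^sub>C x" by transfer (simp add: scaleC_scaleC)
  show "complex_of_real r *\<^sub>C x = r *\<^sub>R x" by transfer (simp add: scaleC_of_real)
  show "cinner x y = cnj (cinner y x)"
  proof -
    have "(\<lambda>n. cnj (cinner (Rep_ell2 y n) (Rep_ell2 x n))) sums cnj (cinner y x)"
      using summable_sums[OF summable_cinner_ell2[of y x]] by (simp add: cinner_ell2.rep_eq sums_cnj)
    then show ?thesis
      by (simp add: cinner_ell2.rep_eq cinner_commute[symmetric] sums_iff)
  qed
  show "cinner x (y + z) = cinner x y + cinner x z"
    using summable_cinner_ell2[of x y] summable_cinner_ell2[of x z]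
    by (simp add: cinner_ell2.rep_eq plus_ell2.rep_eq cinner_add_right suminf_add)
  show "cinner x (c *\<^sub>C y) = c * cinner x y"
    using summable_cinner_ell2[of x y]
    by (simp add: cinner_ell2.rep_eq scaleC_ell2.rep_eq cinner_scaleC_right suminf_mult)
  show "inner x y = Re (cinner x y)"
    using sums_Re[OF summable_sums[OF summable_cinner_ell2[of x y]]]
    by (simp add: cinner_ell2.rep_eq inner_ell2.rep_eq inner_eq_Re_cinner sums_iff)
qed

end

lift_definition tensor_vec :: "'h \<Rightarrow> complex ell2 \<Rightarrow> 'h :: chilbert_space ell2"
  is "\<lambda>h e n. e n *\<^sub>C h"
  by (simp add: norm_scaleC power_mult_distrib summable_mult2)

section \<open>Operators\<close>

text \<open>
  \<open>B(H)\<close> is the set of those bounded real-linear operators that are complex-linear.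
\<close>

definition clinear_ops :: "('h :: chilbert_space \<Rightarrow>\<^sub>L 'h) set" where
  "clinear_ops = {A :: 'h \<Rightarrow>\<^sub>L 'h. \<forall>c x. A (c *\<^sub>C x) = c *\<^sub>C A x}"

lift_definition op_scaleC :: "complex \<Rightarrow> ('h :: chilbert_space \<Rightarrow>\<^sub>L 'h) \<Rightarrow> ('h \<Rightarrow>\<^sub>L 'h)"
  is "\<lambda>c A x. c *\<^sub>C A x"
  by (rule bounded_linear_compose[OF bounded_linear_scaleC])

definition op_csubspace :: "('h :: chilbert_space \<Rightarrow>\<^sub>L 'h) set \<Rightarrow> bool" where
  "op_csubspace S \<longleftrightarrow> S \<subseteq> clinear_ops \<and> subspace S \<and> (\<forall>c. \<forall>A\<in>S. op_scaleC c A \<in> S)"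

definition is_adjoint :: "('h :: chilbert_space \<Rightarrow>\<^sub>L 'h) \<Rightarrow> ('h \<Rightarrow>\<^sub>L 'h) \<Rightarrow> bool" where
  "is_adjoint A B \<longleftrightarrow> (\<forall>x y. cinner (A x) y = cinner x (B y))"

definition selfadjoint_set :: "('h :: chilbert_space \<Rightarrow>\<^sub>L 'h) set \<Rightarrow> bool" where
  "selfadjoint_set S \<longleftrightarrow> (\<forall>A\<in>S. \<exists>B\<in>S. is_adjoint A B)"

definition projections :: "('h :: chilbert_space \<Rightarrow>\<^sub>L 'h) set" where
  "projections = {P \<in> clinear_ops. P o\<^sub>L P = P \<and> is_adjoint P P}"

text \<open>The orthogonal projection onto the closed linear span of the ranges.\<close>

definition proj_Sup :: "('h :: chilbert_space \<Rightarrow>\<^sub>L 'h) set \<Rightarrow> ('h \<Rightarrow>\<^sub>L 'h)" where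
  "proj_Sup S = (THE E :: 'h \<Rightarrow>\<^sub>L 'h. E \<in> projections \<and>
     range (blinfun_apply E) = closure (span (\<Union>P\<in>S. range (blinfun_apply P))))"

definition commutant :: "('h :: chilbert_space \<Rightarrow>\<^sub>L 'h) set \<Rightarrow> ('h \<Rightarrow>\<^sub>L 'h) set" where
  "commutant S = {A \<in> clinear_ops. \<forall>B\<in>S. A o\<^sub>L B = B o\<^sub>L A}"

text \<open>
  The weak* topology of \<open>B(H)\<close> as the dual of the trace class operators: the weak*-continuous
  functionals are \<open>A \<mapsto> \<Sum>\<^sub>n \<langle>x\<^sub>n, A y\<^sub>n\<rangle>\<close> with \<open>\<Sum>\<^sub>n \<parallel>x\<^sub>n\<parallel>\<^sup>2 < \<infinity>\<close> and \<open>\<Sum>\<^sub>n \<parallel>y\<^sub>n\<parallel>\<^sup>2 < \<infinity>\<close>.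
\<close>

definition weakstar :: "('h :: chilbert_space \<Rightarrow>\<^sub>L 'h) topology" where
  "weakstar = topology_generated_by
     {{A \<in> clinear_ops. (\<Sum>n. cinner (x n) (A (y n))) \<in> U} | x y U.
        summable (\<lambda>n. (norm (x n))\<^sup>2) \<and> summable (\<lambda>n. (norm (y n))\<^sup>2) \<and> open U}"

lemma topspace_weakstar:
  "topspace weakstar = (clinear_ops :: ('h :: chilbert_space \<Rightarrow>\<^sub>L 'h) set)"
  unfolding weakstar_def topology_generated_by_topspace
proof (intro equalityI Sup_least Sup_upper)
  let ?basis = "{{A \<in> clinear_ops. (\<Sum>n. cinner (x n) (A (y n :: 'h))) \<in> U} | x y U.
    summable (\<lambda>n. (norm (x n))\<^sup>2) \<and> summable (\<lambda>n. (norm (y n))\<^sup>2) \<and> open U}"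
  show "(clinear_ops :: ('h \<Rightarrow>\<^sub>L 'h) set) \<in> ?basis"
    by (rule CollectI, rule exI[of _ "\<lambda>_. 0"], rule exI[of _ "\<lambda>_. 0"], rule exI[of _ UNIV]) simp
qed auto

definition von_neumann_algebra :: "('h :: chilbert_space \<Rightarrow>\<^sub>L 'h) set \<Rightarrow> bool" where
  "von_neumann_algebra M \<longleftrightarrow>
     op_csubspace M \<and> selfadjoint_set M \<and> closedin weakstar M \<and>
     id_blinfun \<in> M \<and> (\<forall>A\<in>M. \<forall>B\<in>M. A o\<^sub>L B \<in> M)"

section \<open>The tensor product \<open>M \<otimes> B(\<ell>\<^sub>2)\<close>\<close>

lemma summable_bounded_linear_square:
  assumes "bounded_linear f" and x: "summable (\<lambda>n. (norm (x n))\<^sup>2)"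
  shows "summable (\<lambda>n. (norm (f (x n)))\<^sup>2)"
proof -
  obtain K where K: "\<And>x. norm (f x) \<le> norm x * K"
    using bounded_linear.bounded[OF assms(1)] by blast
  show ?thesis
  proof (rule summable_comparison_test')
    show "summable (\<lambda>n. K\<^sup>2 * (norm (x n))\<^sup>2)" by (rule summable_mult[OF x])
    show "norm ((norm (f (x n)))\<^sup>2) \<le> K\<^sup>2 * (norm (x n))\<^sup>2" if "n \<ge> 0" for n
      using power_mono[OF K[of "x n"], of 2] by (simp add: power_mult_distrib mult.commute)
  qed
qed

lift_definition map_ell2 ::
  "('h :: chilbert_space \<Rightarrow>\<^sub>L 'k :: chilbert_space) \<Rightarrow> 'h ell2 \<Rightarrow> 'k ell2" is "\<lambda>A x n. A (x n)"
  by (rule summable_bounded_linear_square)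

lemma norm_map_ell2_le: "norm (map_ell2 A x) \<le> norm x * norm A"
proof (rule power2_le_imp_le)
  have x: "summable (\<lambda>n. (norm (Rep_ell2 x n))\<^sup>2)" and
    Ax: "summable (\<lambda>n. (norm (Rep_ell2 (map_ell2 A x) n))\<^sup>2)"
    using Rep_ell2 by auto
  have "(norm (map_ell2 A x))\<^sup>2 \<le> (\<Sum>n. (norm A)\<^sup>2 * (norm (Rep_ell2 x n))\<^sup>2)"
    unfolding norm_ell2_square
  proof (rule suminf_le[OF _ Ax summable_mult[OF x]])
    show "(norm (Rep_ell2 (map_ell2 A x) n))\<^sup>2 \<le> (norm A)\<^sup>2 * (norm (Rep_ell2 x n))\<^sup>2" for n
      using power_mono[OF norm_blinfun[of A "Rep_ell2 x n"], of 2]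
      by (simp add: map_ell2.rep_eq power_mult_distrib)
  qed
  also have "\<dots> = (norm x * norm A)\<^sup>2"
    by (simp add: suminf_mult[OF x] norm_ell2_square power_mult_distrib mult.commute)
  finally show "(norm (map_ell2 A x))\<^sup>2 \<le> (norm x * norm A)\<^sup>2" .
qed simp

lemma bounded_linear_map_ell2: "bounded_linear (map_ell2 A)"
proof (rule bounded_linear_intro)
  show "map_ell2 A (x + y) = map_ell2 A x + map_ell2 A y" for x y
    by transfer (simp add: linear_add bounded_linear.linear)
  show "map_ell2 A (r *\<^sub>R x) = r *\<^sub>R map_ell2 A x" for r x
    by transfer (simp add: linear_scale bounded_linear.linear)
  show "norm (map_ell2 A x) \<le> norm x * norm A" for x
    by (rule norm_map_ell2_le)
qed

text \<open>The amplification \<open>A \<otimes> Id\<close>.\<close>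

lift_definition amplify :: "('h :: chilbert_space \<Rightarrow>\<^sub>L 'h) \<Rightarrow> ('h ell2 \<Rightarrow>\<^sub>L 'h ell2)" is map_ell2
  by (rule bounded_linear_map_ell2)

lemma amplify_tensor_vec:
  assumes "A \<in> clinear_ops"
  shows "amplify A (tensor_vec h e) = tensor_vec (A h) e"
  using assms unfolding amplify.rep_eq clinear_ops_def by transfer simp

text \<open>The operators \<open>A \<otimes> B\<close> with \<open>A \<in> M\<close> and \<open>B \<in> B(\<ell>\<^sub>2)\<close>.\<close>

definition elementary_tensors ::
  "('h :: chilbert_space \<Rightarrow>\<^sub>L 'h) set \<Rightarrow> ('h ell2 \<Rightarrow>\<^sub>L 'h ell2) set" where
  "elementary_tensors M =
     {T \<in> clinear_ops. \<exists>A\<in>M. \<exists>B\<in>clinear_ops.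
        \<forall>h e. T (tensor_vec h e) = tensor_vec (A h) (B e)}"

text \<open>
  The real span is taken; it is the complex one, since for a complex subspace \<open>M\<close> the
  elementary tensors are stable under complex multiples.
\<close>

definition tensor_B_ell2 ::
  "('h :: chilbert_space \<Rightarrow>\<^sub>L 'h) set \<Rightarrow> ('h ell2 \<Rightarrow>\<^sub>L 'h ell2) set" where
  "tensor_B_ell2 M = weakstar closure_of (span (elementary_tensors M))"

section \<open>Quantum metric spaces\<close>

text \<open>
  A quantum metric is a function on \<open>real\<close> of which only the values at \<open>t \<ge> 0\<close> matter.
\<close>

definition quantum_metric ::
  "('h :: chilbert_space \<Rightarrow>\<^sub>L 'h) set \<Rightarrow> (real \<Rightarrow> ('h \<Rightarrow>\<^sub>L 'h) set) \<Rightarrow> bool" where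
  "quantum_metric M V \<longleftrightarrow>
     (\<forall>t\<ge>0. op_csubspace (V t) \<and> selfadjoint_set (V t) \<and> closedin weakstar (V t)) \<and>
     V 0 = commutant M \<and>
     (\<forall>s\<ge>0. \<forall>t\<ge>0. \<forall>A\<in>V s. \<forall>B\<in>V t. A o\<^sub>L B \<in> V (s + t)) \<and>
     (\<forall>t\<ge>0. V t = (\<Inter>s\<in>{t<..}. V s))"

definition quantum_metric_space ::
  "('h :: chilbert_space \<Rightarrow>\<^sub>L 'h) set \<Rightarrow> (real \<Rightarrow> ('h \<Rightarrow>\<^sub>L 'h) set) \<Rightarrow> bool" where
  "quantum_metric_space M V \<longleftrightarrow> von_neumann_algebra M \<and> quantum_metric M V"

definition qdist_amp ::
  "(real \<Rightarrow> ('h :: chilbert_space \<Rightarrow>\<^sub>L 'h) set) \<Rightarrow> ('h ell2 \<Rightarrow>\<^sub>L 'h ell2) \<Rightarrow>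
     ('h ell2 \<Rightarrow>\<^sub>L 'h ell2) \<Rightarrow> ennreal" where
  "qdist_amp V P Q =
     (INF t\<in>{t. 0 \<le> t \<and> (\<exists>A\<in>V t. P o\<^sub>L amplify A o\<^sub>L Q \<noteq> 0)}. ennreal t)"

text \<open>The distance of projections in \<open>M\<close> itself; \<open>P\<close> is identified with \<open>P \<otimes> Id\<close>.\<close>

definition qdist ::
  "(real \<Rightarrow> ('h :: chilbert_space \<Rightarrow>\<^sub>L 'h) set) \<Rightarrow> ('h \<Rightarrow>\<^sub>L 'h) \<Rightarrow> ('h \<Rightarrow>\<^sub>L 'h) \<Rightarrow> ennreal" where
  "qdist V P Q = qdist_amp V (amplify P) (amplify Q)"

definition qdiam ::
  "('h :: chilbert_space \<Rightarrow>\<^sub>L 'h) set \<Rightarrow> (real \<Rightarrow> ('h \<Rightarrow>\<^sub>L 'h) set) \<Rightarrow> ('h \<Rightarrow>\<^sub>L 'h) \<Rightarrow> ennreal" where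
  "qdiam M V P =
     (if P = 0 then 0
      else SUP (Q, R)\<in>{(Q, R). Q \<in> projections \<inter> tensor_B_ell2 M \<and>
                               R \<in> projections \<inter> tensor_B_ell2 M \<and>
                               (\<exists>A\<in>clinear_ops. Q o\<^sub>L amplify (P o\<^sub>L A o\<^sub>L P) o\<^sub>L R \<noteq> 0)}.
             qdist_amp V Q R)"

definition qnbhd ::
  "('h :: chilbert_space \<Rightarrow>\<^sub>L 'h) set \<Rightarrow> (real \<Rightarrow> ('h \<Rightarrow>\<^sub>L 'h) set) \<Rightarrow> real \<Rightarrow> ('h \<Rightarrow>\<^sub>L 'h) \<Rightarrow>
     ('h \<Rightarrow>\<^sub>L 'h)" where
  "qnbhd M V \<epsilon> P = id_blinfun - proj_Sup {Q \<in> projections \<inter> M. qdist V P Q \<ge> ennreal \<epsilon>}"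

section \<open>Asymptotic dimension\<close>

definition cover :: "('h :: chilbert_space \<Rightarrow>\<^sub>L 'h) set \<Rightarrow> bool" where
  "cover \<P> \<longleftrightarrow> proj_Sup \<P> = id_blinfun"

definition r_disjoint ::
  "('h :: chilbert_space \<Rightarrow>\<^sub>L 'h) set \<Rightarrow> (real \<Rightarrow> ('h \<Rightarrow>\<^sub>L 'h) set) \<Rightarrow> real \<Rightarrow>
     ('h \<Rightarrow>\<^sub>L 'h) set \<Rightarrow> bool" where
  "r_disjoint M V r \<P> \<longleftrightarrow>
     (\<forall>P\<in>\<P>. \<forall>Q\<in>\<P>. P \<noteq> Q \<longrightarrow> qnbhd M V r P o\<^sub>L qnbhd M V r Q = 0)"

definition uniformly_bounded ::
  "('h :: chilbert_space \<Rightarrow>\<^sub>L 'h) set \<Rightarrow> (real \<Rightarrow> ('h \<Rightarrow>\<^sub>L 'h) set) \<Rightarrow> ('h \<Rightarrow>\<^sub>L 'h) set \<Rightarrow> bool" where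
  "uniformly_bounded M V \<P> \<longleftrightarrow> (\<exists>R>0. (SUP P\<in>\<P>. qdiam M V P) \<le> ennreal R)"

definition asdim_le ::
  "('h :: chilbert_space \<Rightarrow>\<^sub>L 'h) set \<Rightarrow> (real \<Rightarrow> ('h \<Rightarrow>\<^sub>L 'h) set) \<Rightarrow> nat \<Rightarrow> bool" where
  "asdim_le M V n \<longleftrightarrow>
     (\<forall>r>0. \<exists>\<P> :: nat \<Rightarrow> ('h \<Rightarrow>\<^sub>L 'h) set.
        (\<forall>i\<le>n. \<P> i \<subseteq> projections \<inter> M \<and> uniformly_bounded M V (\<P> i) \<and> r_disjoint M V r (\<P> i)) \<and>
        cover (\<Union>i\<le>n. \<P> i))"

definition asdim ::
  "('h :: chilbert_space \<Rightarrow>\<^sub>L 'h) set \<Rightarrow> (real \<Rightarrow> ('h \<Rightarrow>\<^sub>L 'h) set) \<Rightarrow> enat" where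
  "asdim M V = (INF n\<in>{n. asdim_le M V n}. enat n)"

section \<open>Metric quotients and direct sums\<close>

text \<open>
  A unitary identification of the Hilbert space \<open>'k\<close> with the range \<open>R H\<close> of the projection \<open>R\<close>.
\<close>

definition unitary_onto_range ::
  "('k :: chilbert_space \<Rightarrow>\<^sub>L 'h :: chilbert_space) \<Rightarrow> ('h \<Rightarrow>\<^sub>L 'h) \<Rightarrow> bool" where
  "unitary_onto_range J R \<longleftrightarrow>
     (\<forall>c x. J (c *\<^sub>C x) = c *\<^sub>C J x) \<and> (\<forall>x. norm (J x) = norm x) \<and>
     range (blinfun_apply J) = range (blinfun_apply R)"

text \<open>
  The compressions \<open>R A R\<close> with \<open>A \<in> S\<close>, viewed as operators on \<open>R H\<close> and transported along \<open>J\<close>.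
\<close>

definition compressions ::
  "('h :: chilbert_space \<Rightarrow>\<^sub>L 'h) \<Rightarrow> ('k :: chilbert_space \<Rightarrow>\<^sub>L 'h) \<Rightarrow>
     ('h \<Rightarrow>\<^sub>L 'h) set \<Rightarrow> ('k \<Rightarrow>\<^sub>L 'k) set" where
  "compressions R J S = {B :: 'k \<Rightarrow>\<^sub>L 'k. \<exists>A\<in>S. \<forall>x. J (B x) = (R o\<^sub>L A o\<^sub>L R) (J x)}"

text \<open>
  \<open>(N, W)\<close> is the metric quotient of \<open>(M, V)\<close> by a central projection \<open>R\<close>. Since \<open>R\<close> is
  central, \<open>R M = R M R\<close>. A subspace of \<open>'h\<close> is not a type, so the Hilbert space of the quotient
  is an arbitrary Hilbert space \<open>'k\<close> with a unitary identification with \<open>R H\<close>.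
\<close>

definition metric_quotient ::
  "('k :: chilbert_space \<Rightarrow>\<^sub>L 'k) set \<Rightarrow> (real \<Rightarrow> ('k \<Rightarrow>\<^sub>L 'k) set) \<Rightarrow>
     ('h :: chilbert_space \<Rightarrow>\<^sub>L 'h) set \<Rightarrow> (real \<Rightarrow> ('h \<Rightarrow>\<^sub>L 'h) set) \<Rightarrow> bool" where
  "metric_quotient N W M V \<longleftrightarrow>
     (\<exists>R J. R \<in> projections \<inter> M \<inter> commutant M \<and> unitary_onto_range J R \<and>
        N = compressions R J M \<and> (\<forall>t\<ge>0. W t = compressions R J (V t)))"

lift_definition op_sum ::
  "('h :: chilbert_space \<Rightarrow>\<^sub>L 'h) \<Rightarrow> ('k :: chilbert_space \<Rightarrow>\<^sub>L 'k) \<Rightarrow>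
     (('h \<times> 'k) \<Rightarrow>\<^sub>L ('h \<times> 'k))"
  is "\<lambda>A B x. (A (fst x), B (snd x))"
  by (intro bounded_linear_Pair bounded_linear_compose[OF _ bounded_linear_fst]
      bounded_linear_compose[OF _ bounded_linear_snd])

definition direct_sum ::
  "('h :: chilbert_space \<Rightarrow>\<^sub>L 'h) set \<Rightarrow> ('k :: chilbert_space \<Rightarrow>\<^sub>L 'k) set \<Rightarrow>
     (('h \<times> 'k) \<Rightarrow>\<^sub>L ('h \<times> 'k)) set" where
  "direct_sum S T = {op_sum A B | A B. A \<in> S \<and> B \<in> T}"

end

theory Submission
  imports Defs
begin

text \<open>
  Both parts compare a quantum metric space with a corner of it: \<open>M\<close> with \<open>R M\<close> for a central
  projection \<open>R\<close>, and \<open>M \<oplus> N\<close> with each of its two summands. Compression to the corner and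
  extension by zero are weak*-continuous, hence carry the projections of the amplified algebras
  into each other. Extension by zero preserves distances and diameters; compression can only
  increase distances and decrease diameters, so compressing a cover of \<open>M\<close> gives a cover of the
  corner with the same bounds and the same disjointness. For a direct sum the complementary summand
  is at infinite distance, so neighborhoods may be computed in the summand, and the union of two
  extended families is again \<open>r\<close>-disjoint.
\<close>


section \<open>Projections onto closed subspaces\<close>

text \<open>Compression cannot lower distances because \<open>R A R\<close> stays in
  \<open>V t\<close>: a central \<open>R\<close> lies in the commutant, which is level
  \<open>0\<close> of the quantum metric, and in a direct sum a block extended by zero is again a
  block sum. Diameters range over projections of the amplified algebra, known only as a
  weak*-closure, so commutation with \<open>R \<otimes> Id\<close> has to be carried from elementary
  tensors to limits. Neighborhoods are complements of suprema, and no exact formula for a compressed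
  neighborhood is at hand. They enter only through absorption: an operator killing every far
  projection kills their supremum, so right multiplication by the neighborhood leaves it unchanged;
  adjoints give absorption on the left. Disjointness is transferred by inserting the neighborhoods
  of the other space into the middle of a product.\<close>

lemma closed_subspace_orthogonal_exists:
  fixes U :: "'a :: {real_inner, complete_space} set"
  assumes U: "subspace U" "closed U"
  shows "\<exists>y\<in>U. \<forall>u\<in>U. inner (x - y) u = 0"
proof -
  define d where "d = (INF u\<in>U. (norm (x - u))\<^sup>2)"
  have U0: "0 \<in> U" using U by (simp add: subspace_0)
  have bdd: "bdd_below ((\<lambda>u. (norm (x - u))\<^sup>2) ` U)"
    by (rule bdd_belowI[of _ 0]) auto
  have d_le: "d \<le> (norm (x - u))\<^sup>2" if "u \<in> U" for u
    unfolding d_def using bdd that by (rule cINF_lower)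
  have "\<exists>u\<in>U. (norm (x - u))\<^sup>2 < d + inverse (real (Suc n))" for n
  proof -
    have "d < d + inverse (real (Suc n))" by simp
    then show ?thesis
      unfolding d_def using cINF_less_iff[OF _ bdd] U0 by (metis empty_iff)
  qed
  then obtain y where yU: "\<And>n. y n \<in> U"
    and y: "\<And>n. (norm (x - y n))\<^sup>2 < d + inverse (real (Suc n))"
    by metis
  have diff: "(norm (y m - y n))\<^sup>2 \<le> 2 * inverse (real (Suc m)) + 2 * inverse (real (Suc n))" for m n
  proof -
    \<comment> \<open>The midpoint lies in \<open>U\<close>, so its squared distance to
      \<open>x\<close> is at least \<open>d\<close>; the parallelogram law then makes the minimizing
      sequence Cauchy.\<close>
    have "(1/2) *\<^sub>R (y m + y n) \<in> U"
      using U yU by (simp add: subspace_add subspace_scale)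
    from d_le[OF this] have "4 * d \<le> 4 * (norm (x - (1/2) *\<^sub>R (y m + y n)))\<^sup>2" by simp
    moreover have "(norm (y m - y n))\<^sup>2 + 4 * (norm (x - (1/2) *\<^sub>R (y m + y n)))\<^sup>2
        = 2 * (norm (x - y m))\<^sup>2 + 2 * (norm (x - y n))\<^sup>2"
      by (simp add: power2_norm_eq_inner algebra_simps inner_commute)
    ultimately show ?thesis using y[of m] y[of n] by linarith
  qed
  have "Cauchy y"
  proof (rule metric_CauchyI)
    fix e :: real assume e: "e > 0"
    obtain N where N: "inverse (real (Suc N)) < e\<^sup>2 / 4"
      using reals_Archimedean[of "e\<^sup>2 / 4"] e by auto
    have "dist (y m) (y n) < e" if "m \<ge> N" "n \<ge> N" for m n
    proof -
      have "inverse (real (Suc m)) \<le> inverse (real (Suc N))"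
        "inverse (real (Suc n)) \<le> inverse (real (Suc N))"
        using that by (simp_all add: field_simps)
      with diff[of m n] N have "(norm (y m - y n))\<^sup>2 < e\<^sup>2" by linarith
      then show ?thesis using e by (simp add: dist_norm power2_less_imp_less)
    qed
    then show "\<exists>N. \<forall>m\<ge>N. \<forall>n\<ge>N. dist (y m) (y n) < e" by blast
  qed
  then obtain l where l: "y \<longlonglongrightarrow> l"
    using Cauchy_convergent_iff convergent_def by blast
  have lU: "l \<in> U" using closed_sequentially[OF U(2) _ l] yU by blast
  have "(norm (x - l))\<^sup>2 \<le> d + 0"
  proof (rule tendsto_le[OF sequentially_bot])
    show "(\<lambda>n. d + inverse (real (Suc n))) \<longlonglongrightarrow> d + 0"
      by (intro tendsto_intros LIMSEQ_inverse_real_of_nat)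
    show "(\<lambda>n. (norm (x - y n))\<^sup>2) \<longlonglongrightarrow> (norm (x - l))\<^sup>2"
      by (intro tendsto_intros l)
  qed (use y in \<open>auto intro!: always_eventually less_imp_le\<close>)
  then have min: "(norm (x - l))\<^sup>2 \<le> (norm (x - u))\<^sup>2" if "u \<in> U" for u
    using d_le[OF that] by linarith
  have "inner (x - l) u = 0" if "u \<in> U" for u
  proof (cases "u = 0")
    case False
    \<comment> \<open>\<open>t\<close> is the minimizer of the squared norm of
      \<open>x - (l + t *\<^sub>R u)\<close>; optimality of \<open>l\<close> forces
      \<open>a = 0\<close>.\<close>
    define a t where "a = inner (x - l) u" and "t = a / (norm u)\<^sup>2"
    have "(norm (x - l))\<^sup>2 \<le> (norm (x - (l + t *\<^sub>R u)))\<^sup>2"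
      using U lU that by (intro min) (simp add: subspace_add subspace_scale)
    also have "\<dots> = (norm (x - l))\<^sup>2 - 2 * t * a + t\<^sup>2 * (norm u)\<^sup>2"
      unfolding a_def power2_norm_eq_inner
      by (simp add: algebra_simps inner_commute power2_eq_square)
    also have "\<dots> = (norm (x - l))\<^sup>2 - a\<^sup>2 / (norm u)\<^sup>2"
      using False by (simp add: t_def field_simps power2_eq_square)
    finally have "a\<^sup>2 / (norm u)\<^sup>2 \<le> 0" by simp
    then have "a = 0" using False by (simp add: divide_le_0_iff)
    then show ?thesis by (simp add: a_def)
  qed simp
  with lU show ?thesis by blast
qed

lemma cinner_zero_right [simp]: "cinner x 0 = 0"
  using cinner_scaleC_right[of x 0 0] by (simp add: scaleC_of_real[of 0, simplified])

lemma cinner_zero_left [simp]: "cinner 0 x = 0"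
  by (metis cinner_commute cinner_zero_right complex_cnj_zero)

lemma cinner_minus_right: "cinner x (- y) = - cinner x y"
  using cinner_add_right[of x y "- y"] by (simp add: eq_neg_iff_add_eq_0 add.commute)

lemma cinner_diff_right: "cinner x (y - z) = cinner x y - cinner x z"
  using cinner_add_right[of x y "- z"] by (simp add: cinner_minus_right)

lemma cinner_diff_left: "cinner (x - y) z = cinner x z - cinner y z"
  by (metis cinner_diff_right cinner_commute complex_cnj_diff)

lemma cinner_eq_zero_iff: "cinner x x = 0 \<longleftrightarrow> x = (0 :: 'a :: chilbert_space)"
  by (simp add: cinner_self)

lemma cinner_ext_left:
  fixes x y :: "'a :: chilbert_space"
  assumes "\<And>z. cinner x z = cinner y z"
  shows "x = y"
  using assms[of "x - y"] cinner_eq_zero_iff[of "x - y"] by (simp add: cinner_diff_left)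

lemma cinner_ext_right:
  fixes x y :: "'a :: chilbert_space"
  assumes "\<And>z. cinner z x = cinner z y"
  shows "x = y"
  by (rule cinner_ext_left) (metis assms cinner_commute)

lemma cinner_eq_inner: "cinner x y = Complex (inner x y) (- inner x (\<i> *\<^sub>C y))"
  by (simp add: complex_eq_iff inner_eq_Re_cinner cinner_scaleC_right)

text \<open>Nearest points give orthogonality for the real inner product only; stability of
  \<open>U\<close> under complex multiples upgrades it to \<open>cinner\<close>. Linearity follows
  from uniqueness of the foot of the perpendicular.\<close>

lemma projection_onto_closed_subspace:
  fixes U :: "'h :: chilbert_space set"
  assumes U: "subspace U" "closed U" and UC: "\<And>c u. u \<in> U \<Longrightarrow> c *\<^sub>C u \<in> U"
  shows "\<exists>E\<in>projections. range (blinfun_apply E) = U"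
proof -
  obtain p where pU: "\<And>x. p x \<in> U" and p: "\<And>x u. u \<in> U \<Longrightarrow> inner (x - p x) u = 0"
    using closed_subspace_orthogonal_exists[OF U] by metis
  have p_eqI: "p x = y" if "y \<in> U" "\<And>u. u \<in> U \<Longrightarrow> inner (x - y) u = 0" for x y
  proof -
    have "p x - y \<in> U" using U pU that by (simp add: subspace_diff)
    then have "inner (x - y) (p x - y) - inner (x - p x) (p x - y) = 0"
      using that(2) p by simp
    then have "inner (p x - y) (p x - y) = 0" by (simp add: algebra_simps)
    then show ?thesis by simp
  qed
  have pC: "cinner (x - p x) u = 0" if "u \<in> U" for x u
    using that p UC by (simp add: cinner_eq_inner zero_complex.code)
  have add: "p (x + y) = p x + p y" for x y
  proof (rule p_eqI)
    show "p x + p y \<in> U" using U pU by (simp add: subspace_add)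
    show "inner (x + y - (p x + p y)) u = 0" if "u \<in> U" for u
      using p[OF that, of x] p[OF that, of y] by (simp add: algebra_simps)
  qed
  have C: "p (c *\<^sub>C x) = c *\<^sub>C p x" for c x
  proof (rule p_eqI)
    show "c *\<^sub>C p x \<in> U" using pU UC by blast
    have "c *\<^sub>C x - c *\<^sub>C p x = c *\<^sub>C (x - p x)"
      using scaleC_add_right[of c "x - p x" "p x"] by (simp add: algebra_simps)
    then show "inner (c *\<^sub>C x - c *\<^sub>C p x) u = 0" if "u \<in> U" for u
      using pC[OF that] by (simp add: inner_eq_Re_cinner cinner_scaleC_left)
  qed
  have "bounded_linear p"
  proof (rule bounded_linear_intro[where K = 1])
    show "p (r *\<^sub>R x) = r *\<^sub>R p x" for r x
      using C[of "complex_of_real r"] by (simp add: scaleC_of_real)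
    show "norm (p x) \<le> norm x * 1" for x
    proof (rule power2_le_imp_le)
      have "(norm x)\<^sup>2 = (norm (x - p x))\<^sup>2 + (norm (p x))\<^sup>2 + 2 * inner (x - p x) (p x)"
        by (simp add: power2_norm_eq_inner algebra_simps inner_commute)
      then show "(norm (p x))\<^sup>2 \<le> (norm x * 1)\<^sup>2" using p[OF pU] by simp
    qed simp
  qed (rule add)
  then have app: "blinfun_apply (Blinfun p) = p" by (rule bounded_linear_Blinfun_apply)
  have fixed: "p u = u" if "u \<in> U" for u by (rule p_eqI) (use that in simp_all)
  have "cinner (p x) y = cinner x (p y)" for x y
  proof -
    have "cinner (p x) (y - p y) = 0"
      by (metis pC pU cinner_commute complex_cnj_zero)
    with pC[OF pU, of x y] show ?thesis by (simp add: cinner_diff_left cinner_diff_right)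
  qed
  then have "Blinfun p \<in> projections"
    unfolding projections_def clinear_ops_def is_adjoint_def
    using fixed pU by (auto simp: app C intro!: blinfun_eqI)
  moreover have "range p = U" using fixed pU by (metis image_subset_iff rangeI subsetI subset_antisym)
  ultimately show ?thesis using app by metis
qed

lemma projection_fixes_range:
  "P \<in> projections \<Longrightarrow> x \<in> range (blinfun_apply P) \<Longrightarrow> P x = x"
  by (auto simp: projections_def) (metis blinfun_apply_blinfun_compose)

text \<open>Equal ranges give \<open>Q P = P\<close> and \<open>P Q = Q\<close>; the adjoint of the
  first equation is \<open>P Q = P\<close>.\<close>

lemma projection_range_inject:
  assumes "P \<in> projections" "Q \<in> projections"
    and "range (blinfun_apply P) = range (blinfun_apply Q)"
  shows "P = Q"
proof (rule blinfun_eqI, rule cinner_ext_left)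
  fix x y
  have a: "cinner (P x) y = cinner x (P y)" "cinner (Q x) y = cinner x (Q y)" for x y
    using assms by (auto simp: projections_def is_adjoint_def)
  have b: "P (Q x) = Q x" "Q (P x) = P x" for x
    using assms by (metis projection_fixes_range rangeI)+
  show "cinner (P x) y = cinner (Q x) y" using a b by metis
qed

lemma subspace_closure:
  fixes U :: "'a :: real_normed_vector set"
  assumes "subspace U"
  shows "subspace (closure U)"
proof (rule subspaceI)
  show "0 \<in> closure U"
    using assms closure_subset subspace_0 by blast
  show "x + y \<in> closure U" if "x \<in> closure U" "y \<in> closure U" for x y
  proof -
    from that obtain a b where "\<And>n. a n \<in> U" "a \<longlonglongrightarrow> x" "\<And>n. b n \<in> U" "b \<longlonglongrightarrow> y"
      unfolding closure_sequential by blast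
    then have "\<And>n. a n + b n \<in> U" "(\<lambda>n. a n + b n) \<longlonglongrightarrow> x + y"
      using assms by (auto intro: subspace_add tendsto_add)
    then show ?thesis
      unfolding closure_sequential by (intro exI[of _ "\<lambda>n. a n + b n"]) simp
  qed
  show "c *\<^sub>R x \<in> closure U" if "x \<in> closure U" for c x
  proof -
    from that obtain a where "\<And>n. a n \<in> U" "a \<longlonglongrightarrow> x"
      unfolding closure_sequential by blast
    then have "\<And>n. c *\<^sub>R a n \<in> U" "(\<lambda>n. c *\<^sub>R a n) \<longlonglongrightarrow> c *\<^sub>R x"
      using assms by (auto intro: subspace_scale tendsto_scaleR)
    then show ?thesis
      unfolding closure_sequential by (intro exI[of _ "\<lambda>n. c *\<^sub>R a n"]) simp
  qed
qed

text \<open>Existence and uniqueness for the \<open>THE\<close> in \<open>proj_Sup\<close>. The span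
  there is real, but the ranges are stable under complex multiples, so its closure is a complex
  subspace.\<close>

lemma
  assumes S: "S \<subseteq> projections"
  shows proj_Sup_in_projections: "proj_Sup S \<in> projections"
    and range_proj_Sup: "range (blinfun_apply (proj_Sup S)) =
      closure (span (\<Union>P\<in>S. range (blinfun_apply P)))"
proof -
  let ?A = "\<Union>P\<in>S. range (blinfun_apply P)"
  have A: "c *\<^sub>C u \<in> ?A" if u: "u \<in> ?A" for c u
  proof -
    obtain P x where "P \<in> S" "u = P x" using u by blast
    moreover from this S have "c *\<^sub>C u = P (c *\<^sub>C x)" by (auto simp: projections_def clinear_ops_def)
    ultimately show ?thesis by blast
  qed
  have lin: "linear (\<lambda>x. c *\<^sub>C (x :: 'a))" for c
    using bounded_linear_scaleC bounded_linear.linear by blast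
  have "(\<lambda>x. c *\<^sub>C x) ` span ?A \<subseteq> span ?A" for c
    unfolding linear_span_image[OF lin, symmetric] using A by (intro span_mono) blast
  then have "(\<lambda>x. c *\<^sub>C x) ` closure (span ?A) \<subseteq> closure (span ?A)" for c
    by (intro image_closure_subset linear_continuous_on bounded_linear_scaleC closed_closure)
      (meson closure_subset subset_trans)
  then have "\<exists>E\<in>projections. range (blinfun_apply E) = closure (span ?A)"
    using \<open>\<And>c. (\<lambda>x. c *\<^sub>C x) ` closure (span ?A) \<subseteq> closure (span ?A)\<close>
    by (intro projection_onto_closed_subspace subspace_closure subspace_span closed_closure) blast
  then have "\<exists>!E. E \<in> projections \<and> range (blinfun_apply E) = closure (span ?A)"
    by (metis projection_range_inject)
  from theI'[OF this] show "proj_Sup S \<in> projections"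
    "range (blinfun_apply (proj_Sup S)) = closure (span ?A)"
    unfolding proj_Sup_def by auto
qed

lemma proj_Sup_absorbs:
  assumes "S \<subseteq> projections" "P \<in> S"
  shows "proj_Sup S (P x) = P x"
proof (rule projection_fixes_range[OF proj_Sup_in_projections[OF assms(1)]])
  show "P x \<in> range (blinfun_apply (proj_Sup S))"
    unfolding range_proj_Sup[OF assms(1)]
    using assms(2) by (meson UN_I closure_subset rangeI span_base subsetD)
qed

text \<open>The kernel of \<open>T\<close> is a closed subspace containing all the ranges. The
  codomain is arbitrary so that \<open>T\<close> may lead into or out of a corner.\<close>

lemma zero_on_proj_Sup:
  fixes T :: "'h :: chilbert_space \<Rightarrow>\<^sub>L 'b :: real_normed_vector"
  assumes S: "S \<subseteq> projections" and T: "\<And>P x. P \<in> S \<Longrightarrow> T (P x) = 0"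
  shows "T (proj_Sup S x) = 0"
proof -
  let ?A = "\<Union>P\<in>S. range (blinfun_apply P)" and ?K = "{x. T x = 0}"
  have "span ?A \<subseteq> ?K"
    using T by (intro span_minimal) (auto simp: subspace_def blinfun.bilinear_simps)
  moreover have "closed ?K" by (intro closed_Collect_eq continuous_intros)
  ultimately have "closure (span ?A) \<subseteq> ?K" by (rule closure_minimal)
  then show ?thesis using range_proj_Sup[OF S] by blast
qed


section \<open>Adjoint pairs and amplifications\<close>

text \<open>Generalizes \<open>is_adjoint\<close> to maps between different spaces, as needed for
  \<open>J\<close>. The adjoint is carried along as data instead of being constructed.\<close>

definition adjoint_pair ::
  "('a :: chilbert_space \<Rightarrow>\<^sub>L 'b :: chilbert_space) \<Rightarrow> ('b \<Rightarrow>\<^sub>L 'a) \<Rightarrow> bool" where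
  "adjoint_pair F G \<longleftrightarrow> (\<forall>x y. cinner (F x) y = cinner x (G y))"

lemma adjoint_pairD: "adjoint_pair F G \<Longrightarrow> cinner (F x) y = cinner x (G y)"
  by (simp add: adjoint_pair_def)

lemma adjoint_pair_sym: "adjoint_pair F G \<Longrightarrow> adjoint_pair G F"
  unfolding adjoint_pair_def by (metis cinner_commute)

lemma is_adjoint_iff_adjoint_pair: "is_adjoint A B \<longleftrightarrow> adjoint_pair A B"
  by (simp add: is_adjoint_def adjoint_pair_def)

lemma adjoint_pair_compose:
  "adjoint_pair F G \<Longrightarrow> adjoint_pair F' G' \<Longrightarrow> adjoint_pair (F' o\<^sub>L F) (G o\<^sub>L G')"
  by (simp add: adjoint_pair_def)

text \<open>The scalar moves to the other side of the inner product and back, so an adjoint pair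
  brings complex linearity with it.\<close>

lemma adjoint_pair_scaleC:
  assumes "adjoint_pair F G"
  shows "F (c *\<^sub>C x) = c *\<^sub>C F x"
  by (rule cinner_ext_left) (simp add: adjoint_pairD[OF assms] cinner_scaleC_left)

lemma projections_iff: "P \<in> projections \<longleftrightarrow> P o\<^sub>L P = P \<and> adjoint_pair P P"
  by (auto simp: projections_def is_adjoint_iff_adjoint_pair clinear_ops_def adjoint_pair_scaleC)

lemma projection_idem: "P \<in> projections \<Longrightarrow> P (P x) = P x"
  by (metis projections_iff blinfun_apply_blinfun_compose)

text \<open>Extends \<open>amplify\<close> to maps between different spaces, so that
  \<open>J\<close> and \<open>Jd\<close> can be amplified.\<close>

lift_definition ampl :: "('a :: chilbert_space \<Rightarrow>\<^sub>L 'b :: chilbert_space) \<Rightarrow> ('a ell2 \<Rightarrow>\<^sub>L 'b ell2)"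
  is map_ell2
  by (rule bounded_linear_map_ell2)

lemma amplify_eq_ampl: "amplify = ampl"
  by (rule ext) (simp add: ampl_def amplify_def)

lemma Rep_ampl: "Rep_ell2 (ampl A x) n = A (Rep_ell2 x n)"
  by (simp add: ampl.rep_eq map_ell2.rep_eq)

lemma ell2_eqI: "(\<And>n. Rep_ell2 x n = Rep_ell2 y n) \<Longrightarrow> x = y"
  by (metis Rep_ell2_inject ext)

lemma ampl_compose: "ampl (A o\<^sub>L B) = ampl A o\<^sub>L ampl B"
  by (rule blinfun_eqI, rule ell2_eqI) (simp add: Rep_ampl)

lemma ampl_adjoint_pair: "adjoint_pair F G \<Longrightarrow> adjoint_pair (ampl F) (ampl G)"
  by (simp add: adjoint_pair_def cinner_ell2.rep_eq Rep_ampl)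

lemma Rep_tensor_vec: "Rep_ell2 (tensor_vec h e) n = Rep_ell2 e n *\<^sub>C h"
  by (simp add: tensor_vec.rep_eq)

lemma ampl_tensor_vec:
  assumes "adjoint_pair F G"
  shows "ampl F (tensor_vec h e) = tensor_vec (F h) e"
  by (rule ell2_eqI) (simp add: Rep_ampl Rep_tensor_vec adjoint_pair_scaleC[OF assms])

lemma Rep_ell2_sum: "Rep_ell2 (sum f A) n = (\<Sum>i\<in>A. Rep_ell2 (f i) n)"
  by (induction A rule: infinite_finite_induct) (simp_all add: zero_ell2.rep_eq plus_ell2.rep_eq)

lift_definition unit_ell2 :: "nat \<Rightarrow> complex ell2" is "\<lambda>k n. if n = k then 1 else 0"
proof -
  fix k :: nat
  show "summable (\<lambda>n. (norm (if n = k then 1 else 0 :: complex))\<^sup>2)"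
    by (rule summable_finite[of "{k}"]) auto
qed

text \<open>The squared norm of the remainder is a tail of a convergent series. Hence a bounded
  operator is determined by its values on elementary tensors.\<close>

lemma tensor_vec_unit_sums:
  "(\<lambda>k. tensor_vec (Rep_ell2 x k) (unit_ell2 k)) sums (x :: 'h :: chilbert_space ell2)"
proof -
  let ?s = "\<lambda>K. \<Sum>k<K. tensor_vec (Rep_ell2 x k) (unit_ell2 k)"
  let ?f = "\<lambda>n. (norm (Rep_ell2 x n))\<^sup>2"
  have f: "summable ?f" using Rep_ell2[of x] by simp
  have r: "Rep_ell2 (x - ?s K) n = (if n < K then 0 else Rep_ell2 x n)" for K n
  proof -
    have "(if n = k then 1 else 0 :: complex) *\<^sub>C (h :: 'h) = (if n = k then h else 0)" for k h
      using scaleC_of_real[of 1 h] scaleC_of_real[of 0 h] by simp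
    then show ?thesis
      by (simp add: minus_ell2.rep_eq Rep_ell2_sum Rep_tensor_vec unit_ell2.rep_eq)
  qed
  have norm: "(norm (x - ?s K))\<^sup>2 = suminf ?f - sum ?f {..<K}" for K
  proof -
    have "(norm (x - ?s K))\<^sup>2 = (\<Sum>n. if n < K then 0 else ?f n)"
      unfolding norm_ell2_square r by (rule arg_cong[of _ _ suminf]) auto
    also have "\<dots> = (\<Sum>n. ?f n - (if n \<in> {..<K} then ?f n else 0))"
      by (rule arg_cong[of _ _ suminf]) auto
    also have "\<dots> = suminf ?f - sum ?f {..<K}"
      using sums_diff[OF summable_sums[OF f] sums_If_finite_set[of "{..<K}" ?f]]
      by (simp add: sums_iff)
    finally show ?thesis .
  qed
  have "(\<lambda>K. suminf ?f - sum ?f {..<K}) \<longlonglongrightarrow> suminf ?f - suminf ?f"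
    by (intro tendsto_intros summable_LIMSEQ f)
  then have "(\<lambda>K. sqrt ((norm (x - ?s K))\<^sup>2)) \<longlonglongrightarrow> sqrt 0"
    unfolding norm by (intro tendsto_real_sqrt) simp
  then have "(\<lambda>K. norm (?s K - x)) \<longlonglongrightarrow> 0"
    by (simp add: norm_minus_commute)
  then have "(\<lambda>K. ?s K - x) \<longlonglongrightarrow> 0" by (rule tendsto_norm_zero_cancel)
  then show ?thesis unfolding sums_def by (rule LIM_zero_cancel)
qed

lemma blinfun_eq_on_tensor_vecs:
  fixes S T :: "'h :: chilbert_space ell2 \<Rightarrow>\<^sub>L 'b :: real_normed_vector"
  assumes "\<And>h e. S (tensor_vec h e) = T (tensor_vec h e)"
  shows "S = T"
proof (rule blinfun_eqI)
  fix x
  note s = bounded_linear.sums[OF blinfun.bounded_linear_right tensor_vec_unit_sums[of x]]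
  show "S x = T x"
    using s[of S] s[of T] unfolding assms by (rule sums_unique2)
qed

section \<open>Weak* continuity\<close>

lemma conj_clinear:
  assumes "adjoint_pair F G" "T \<in> clinear_ops"
  shows "F o\<^sub>L T o\<^sub>L G \<in> clinear_ops"
  using assms(2) adjoint_pair_scaleC[OF assms(1)] adjoint_pair_scaleC[OF adjoint_pair_sym[OF assms(1)]]
  by (simp add: clinear_ops_def)

lemma openin_weakstar_basis:
  assumes "summable (\<lambda>n. (norm (x n))\<^sup>2)" "summable (\<lambda>n. (norm (y n))\<^sup>2)" "open U"
  shows "openin weakstar {A \<in> clinear_ops. (\<Sum>n. cinner (x n) (blinfun_apply A (y n :: 'h :: chilbert_space))) \<in> U}"
  unfolding weakstar_def using assms by (intro topology_generated_by_Basis) blast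

text \<open>Moving \<open>F\<close> across the inner product replaces the sequences \<open>x\<close>
  and \<open>y\<close> by their images under \<open>G\<close>, so preimages of subbasic sets are
  subbasic.\<close>

lemma continuous_map_weakstar_conj:
  fixes F :: "'a :: chilbert_space \<Rightarrow>\<^sub>L 'b :: chilbert_space"
  assumes FG: "adjoint_pair F G"
  shows "continuous_map weakstar weakstar (\<lambda>T. F o\<^sub>L T o\<^sub>L G)"
proof -
  let ?B = "{{A \<in> clinear_ops. (\<Sum>n. cinner (x n) (A (y n :: 'b))) \<in> U} | x y U.
    summable (\<lambda>n. (norm (x n))\<^sup>2) \<and> summable (\<lambda>n. (norm (y n))\<^sup>2) \<and> open U}"
  have "continuous_map weakstar (topology_generated_by ?B) (\<lambda>T. F o\<^sub>L T o\<^sub>L G)"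
  proof (rule continuous_on_generated_topo)
    fix X assume "X \<in> ?B"
    then obtain x y U where X: "X = {A \<in> clinear_ops. (\<Sum>n. cinner (x n) (A (y n :: 'b))) \<in> U}"
      and xy: "summable (\<lambda>n. (norm (x n))\<^sup>2)" "summable (\<lambda>n. (norm (y n))\<^sup>2)" and U: "open U"
      by blast
    have G: "summable (\<lambda>n. (norm (G (z n)))\<^sup>2)" if "summable (\<lambda>n. (norm (z n))\<^sup>2)" for z
      using summable_bounded_linear_square[OF blinfun.bounded_linear_right that] .
    have "(\<lambda>T. F o\<^sub>L T o\<^sub>L G) -` X \<inter> topspace weakstar
        = {A \<in> clinear_ops. (\<Sum>n. cinner (G (x n)) (A (G (y n)))) \<in> U}"
      using conj_clinear[OF FG]
      by (auto simp: X topspace_weakstar adjoint_pairD[OF adjoint_pair_sym[OF FG]])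
    then show "openin weakstar ((\<lambda>T. F o\<^sub>L T o\<^sub>L G) -` X \<inter> topspace weakstar)"
      using openin_weakstar_basis[OF G[OF xy(1)] G[OF xy(2)] U] by simp
  next
    have "\<Union>?B = clinear_ops"
      using topspace_weakstar unfolding weakstar_def topology_generated_by_topspace .
    then show "(\<lambda>T. F o\<^sub>L T o\<^sub>L G) ` topspace weakstar \<subseteq> \<Union>?B"
      using conj_clinear[OF FG] by (auto simp: topspace_weakstar)
  qed
  then show ?thesis unfolding weakstar_def by simp
qed

text \<open>
  The condition \<open>\<langle>x, A S y\<rangle> = \<langle>S x, A y\<rangle>\<close> says that the weak*-continuous functional
  given by the sequences \<open>(x, S x)\<close> and \<open>(S y, - y)\<close> vanishes at \<open>A\<close>.
\<close>

lemma closedin_weakstar_commutant: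
  fixes S :: "'h :: chilbert_space \<Rightarrow>\<^sub>L 'h"
  assumes S: "adjoint_pair S S"
  shows "closedin weakstar (commutant {S})"
proof -
  define u where "u x y n = (if n = 0 then x else if n = Suc 0 then y else 0)" for x y :: 'h and n :: nat
  have u: "summable (\<lambda>n. (norm (u x y n))\<^sup>2)" for x y
    by (rule summable_finite[of "{0, Suc 0}"]) (auto simp: u_def)
  have sum: "(\<Sum>n. cinner (u x (S x) n) (A (u (S y) (- y) n))) = cinner x (A (S y)) - cinner (S x) (A y)"
    for A :: "'h \<Rightarrow>\<^sub>L 'h" and x y
    by (subst suminf_finite[of "{0, Suc 0}"])
      (auto simp: u_def blinfun.minus_right cinner_minus_right)
  define C where "C x y = {A \<in> clinear_ops. cinner x (blinfun_apply A (S y)) = cinner (S x) (blinfun_apply A y)}" for x y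
  have "closedin weakstar (C x y)" for x y
  proof -
    have "topspace weakstar - C x y =
        {A \<in> clinear_ops. (\<Sum>n. cinner (u x (S x) n) (blinfun_apply A (u (S y) (- y) n))) \<in> - {0}}"
      unfolding sum by (auto simp: topspace_weakstar C_def)
    moreover have "openin weakstar \<dots>"
      using u by (intro openin_weakstar_basis) auto
    ultimately show ?thesis by (simp add: closedin_def topspace_weakstar C_def)
  qed
  moreover have "commutant {S} = (\<Inter>(x, y)\<in>UNIV. C x y)"
  proof (intro set_eqI iffI)
    fix A assume "A \<in> (\<Inter>(x, y)\<in>UNIV. C x y)"
    then have A: "A \<in> C x y" for x y by blast
    have "A (S y) = S (A y)" for y
    proof (rule cinner_ext_right)
      show "cinner x (A (S y)) = cinner x (S (A y))" for x
        using A[of x y] by (simp add: C_def adjoint_pairD[OF S])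
    qed
    with A show "A \<in> commutant {S}" by (simp add: commutant_def C_def blinfun_eqI)
  next
    fix A assume A: "A \<in> commutant {S}"
    then have "A o\<^sub>L S = S o\<^sub>L A" by (simp add: commutant_def)
    then have "A (S y) = S (A y)" for y by (metis blinfun_apply_blinfun_compose)
    with A show "A \<in> (\<Inter>(x, y)\<in>UNIV. C x y)"
      by (simp add: C_def commutant_def adjoint_pairD[OF S])
  qed
  ultimately show ?thesis by (auto intro!: closedin_Inter)
qed

lemma subspace_commutant: "subspace (commutant S)"
proof (rule subspaceI)
  show "0 \<in> commutant S"
    using scaleC_scaleR[where r = 0] by (auto simp: commutant_def clinear_ops_def)
  show "A + B \<in> commutant S" if "A \<in> commutant S" "B \<in> commutant S" for A B
    using that
    by (simp add: commutant_def clinear_ops_def blinfun.add_left scaleC_add_right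
        bounded_bilinear.add_left[OF bounded_bilinear_blinfun_compose]
        bounded_bilinear.add_right[OF bounded_bilinear_blinfun_compose])
  show "r *\<^sub>R A \<in> commutant S" if "A \<in> commutant S" for r A
    using that
    by (simp add: commutant_def clinear_ops_def blinfun.scaleR_left scaleC_scaleR
        bounded_bilinear.scaleR_left[OF bounded_bilinear_blinfun_compose]
        bounded_bilinear.scaleR_right[OF bounded_bilinear_blinfun_compose])
qed

text \<open>The commutant of \<open>ampl S\<close> is a weak*-closed subspace, so elementary tensors
  suffice. With \<open>S = R\<close> this shows that \<open>R \<otimes> Id\<close> commutes with the
  amplified algebra.\<close>

lemma tensor_B_ell2_commutes:
  assumes S: "adjoint_pair S S" and M: "\<And>A. A \<in> M \<Longrightarrow> A o\<^sub>L S = S o\<^sub>L A"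
    and T: "T \<in> tensor_B_ell2 M"
  shows "T o\<^sub>L ampl S = ampl S o\<^sub>L T"
proof -
  have "T o\<^sub>L ampl S = ampl S o\<^sub>L T" if T: "T \<in> elementary_tensors M" for T
  proof (rule blinfun_eq_on_tensor_vecs)
    fix h e
    obtain A B where AB: "A \<in> M" "\<And>h e. T (tensor_vec h e) = tensor_vec (A h) (blinfun_apply B e)"
      using T unfolding elementary_tensors_def by blast
    then have "A (S h) = S (A h)" using M by (metis blinfun_apply_blinfun_compose)
    then show "(T o\<^sub>L ampl S) (tensor_vec h e) = (ampl S o\<^sub>L T) (tensor_vec h e)"
      by (simp add: AB ampl_tensor_vec[OF S])
  qed
  then have "elementary_tensors M \<subseteq> commutant {ampl S}"
    by (auto simp: commutant_def elementary_tensors_def)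
  then have "span (elementary_tensors M) \<subseteq> commutant {ampl S}"
    by (intro span_minimal subspace_commutant)
  then have "tensor_B_ell2 M \<subseteq> commutant {ampl S}"
    unfolding tensor_B_ell2_def
    by (intro closure_of_minimal closedin_weakstar_commutant ampl_adjoint_pair S)
  with T show ?thesis by (auto simp: commutant_def)
qed

text \<open>Conjugation is linear, weak*-continuous and preserves elementary tensors, so it passes
  to the closed span. \<open>F = Jd\<close> gives compression, \<open>F = J\<close> extension by
  zero.\<close>

lemma tensor_B_ell2_conj:
  fixes F :: "'a :: chilbert_space \<Rightarrow>\<^sub>L 'b :: chilbert_space"
  assumes FG: "adjoint_pair F G" and MN: "\<And>A. A \<in> M \<Longrightarrow> F o\<^sub>L A o\<^sub>L G \<in> N"
    and T: "T \<in> tensor_B_ell2 M"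
  shows "ampl F o\<^sub>L T o\<^sub>L ampl G \<in> tensor_B_ell2 N"
proof -
  let ?c = "\<lambda>T. ampl F o\<^sub>L T o\<^sub>L ampl G"
  note FG' = ampl_adjoint_pair[OF FG]
  have "?c T \<in> elementary_tensors N" if T: "T \<in> elementary_tensors M" for T
  proof -
    obtain A B where AB: "A \<in> M" "B \<in> clinear_ops"
      "\<And>h e. T (tensor_vec h e) = tensor_vec (A h) (blinfun_apply B e)" and "T \<in> clinear_ops"
      using T unfolding elementary_tensors_def by blast
    then have "?c T (tensor_vec h e) = tensor_vec ((F o\<^sub>L A o\<^sub>L G) h) (B e)" for h e
      by (simp add: ampl_tensor_vec[OF FG] ampl_tensor_vec[OF adjoint_pair_sym[OF FG]])
    then show ?thesis
      using MN[OF AB(1)] AB(2) conj_clinear[OF FG' \<open>T \<in> clinear_ops\<close>]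
      unfolding elementary_tensors_def by blast
  qed
  moreover have "linear ?c"
    by (intro linearI blinfun_eqI) (simp_all add: blinfun.bilinear_simps)
  ultimately have "?c ` span (elementary_tensors M) \<subseteq> span (elementary_tensors N)"
    by (subst linear_span_image[symmetric]) (auto intro!: span_mono)
  then have "?c ` tensor_B_ell2 M \<subseteq> tensor_B_ell2 N"
    unfolding tensor_B_ell2_def
    using continuous_map_image_closure_subset[OF continuous_map_weakstar_conj[OF FG']]
      closure_of_mono by (meson subset_trans)
  with T show ?thesis by blast
qed


section \<open>Corners\<close>

text \<open>
  \<open>J\<close> identifies the Hilbert space \<open>'k\<close> with the range of the projection \<open>J o\<^sub>L Jd\<close>, so that
  \<open>down\<close> is the compression to this corner and \<open>up\<close> the extension by zero.
\<close>

locale corner =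
  fixes J :: "'k :: chilbert_space \<Rightarrow>\<^sub>L 'h :: chilbert_space" and Jd :: "'h \<Rightarrow>\<^sub>L 'k"
  assumes adj: "adjoint_pair J Jd" and Jd_J [simp]: "Jd (J x) = x"
begin

definition down :: "('h \<Rightarrow>\<^sub>L 'h) \<Rightarrow> ('k \<Rightarrow>\<^sub>L 'k)" where "down A = Jd o\<^sub>L A o\<^sub>L J"
definition up :: "('k \<Rightarrow>\<^sub>L 'k) \<Rightarrow> ('h \<Rightarrow>\<^sub>L 'h)" where "up B = J o\<^sub>L B o\<^sub>L Jd"
definition R :: "'h \<Rightarrow>\<^sub>L 'h" where "R = J o\<^sub>L Jd"

lemma down_apply [simp]: "down A x = Jd (A (J x))" by (simp add: down_def)
lemma up_apply [simp]: "up B x = J (B (Jd x))" by (simp add: up_def)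
lemma R_apply [simp]: "R x = J (Jd x)" by (simp add: R_def)

lemma down_up [simp]: "down (up B) = B" by (rule blinfun_eqI) simp

lemma up_eq_iff [simp]: "up B = up C \<longleftrightarrow> B = C" by (metis down_up)

lemma up_0 [simp]: "up 0 = 0" by (rule blinfun_eqI) (simp add: blinfun.zero_left blinfun.zero_right)

lemma up_eq_0_iff [simp]: "up B = 0 \<longleftrightarrow> B = 0" using up_eq_iff[of B 0] by simp

lemma up_down: "up (down A) = R o\<^sub>L A o\<^sub>L R" by (rule blinfun_eqI) simp

lemma J_scaleC: "J (c *\<^sub>C x) = c *\<^sub>C J x" by (rule adjoint_pair_scaleC[OF adj])
lemma Jd_scaleC: "Jd (c *\<^sub>C x) = c *\<^sub>C Jd x"
  by (rule adjoint_pair_scaleC[OF adjoint_pair_sym[OF adj]])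

lemma R_selfadjoint: "adjoint_pair R R"
  unfolding R_def by (rule adjoint_pair_compose[OF adjoint_pair_sym[OF adj] adj])

lemma up_clinear: "A \<in> clinear_ops \<Longrightarrow> up A \<in> clinear_ops"
  by (simp add: clinear_ops_def J_scaleC Jd_scaleC)

lemma down_clinear: "A \<in> clinear_ops \<Longrightarrow> down A \<in> clinear_ops"
  by (simp add: clinear_ops_def J_scaleC Jd_scaleC)

lemma up_adjoint: "adjoint_pair P Q \<Longrightarrow> adjoint_pair (up P) (up Q)"
  by (simp add: adjoint_pair_def adjoint_pairD[OF adj]) (metis adj adjoint_pair_def adjoint_pair_sym)

lemma down_adjoint: "adjoint_pair P Q \<Longrightarrow> adjoint_pair (down P) (down Q)"
  by (simp add: adjoint_pair_def) (metis adj adjoint_pair_def adjoint_pair_sym)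

lemma up_projection: "P \<in> projections \<Longrightarrow> up P \<in> projections"
  by (auto simp: projections_iff projection_idem up_adjoint intro!: blinfun_eqI)

text \<open>An operator commuting with \<open>R\<close> is block diagonal for the corner and its
  complement; so \<open>J\<close>, and in the next lemma \<open>Jd\<close>, intertwines it with its
  compression.\<close>

lemma commutes_apply_J:
  assumes "T o\<^sub>L R = R o\<^sub>L T"
  shows "T (J x) = J (down T x)"
proof -
  have "T (R (J x)) = R (T (J x))" using assms by (metis blinfun_apply_blinfun_compose)
  then show ?thesis by simp
qed

lemma commutes_Jd_apply:
  assumes "T o\<^sub>L R = R o\<^sub>L T"
  shows "Jd (T x) = down T (Jd x)"
proof -
  have "Jd (T (R x)) = Jd (R (T x))" using assms by (metis blinfun_apply_blinfun_compose)
  then show ?thesis by simp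
qed

lemma down_projection:
  assumes P: "P \<in> projections" and "P o\<^sub>L R = R o\<^sub>L P"
  shows "down P \<in> projections"
proof -
  have "down P (down P x) = down P x" for x
    using commutes_apply_J[OF assms(2), of x] projection_idem[OF P, of "J x"] by simp
  then show ?thesis using P by (auto simp: projections_iff down_adjoint intro!: blinfun_eqI)
qed

lemma corner_ampl: "corner (ampl J) (ampl Jd)"
proof
  show "adjoint_pair (ampl J) (ampl Jd)" by (rule ampl_adjoint_pair[OF adj])
  show "ampl Jd (ampl J x) = x" for x by (rule ell2_eqI) (simp add: Rep_ampl)
qed

end

section \<open>Neighborhoods and covers as vanishing conditions\<close>

lemma Collect_projections_subset: "{Q \<in> projections \<inter> M. \<phi> Q} \<subseteq> projections"
  by blast

lemma qnbhd_selfadjoint: "adjoint_pair (qnbhd M V r P) (qnbhd M V r P)"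
  using proj_Sup_in_projections[OF Collect_projections_subset, of M "\<lambda>Q. ennreal r \<le> qdist V P Q"]
  by (simp add: qnbhd_def adjoint_pair_def projections_iff blinfun.diff_left cinner_diff_left cinner_diff_right)

lemma qnbhd_vanishes:
  assumes "Q \<in> projections" "Q \<in> M" "ennreal r \<le> qdist V P Q"
  shows "qnbhd M V r P (Q x) = 0"
  using proj_Sup_absorbs[OF Collect_projections_subset, of Q M "\<lambda>Q. ennreal r \<le> qdist V P Q" x] assms
  by (simp add: qnbhd_def blinfun.diff_left)

text \<open>The neighborhood is the identity minus the supremum of the far projections, and
  \<open>T\<close> kills that supremum because it kills each of them.\<close>

lemma absorb_qnbhd:
  fixes T :: "'h :: chilbert_space \<Rightarrow>\<^sub>L 'b :: real_normed_vector"
  assumes "\<And>Q y. Q \<in> projections \<Longrightarrow> Q \<in> M \<Longrightarrow> ennreal r \<le> qdist V P Q \<Longrightarrow> T (Q y) = 0"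
  shows "T (qnbhd M V r P x) = T x"
  using zero_on_proj_Sup[OF Collect_projections_subset, of M "\<lambda>Q. ennreal r \<le> qdist V P Q" T x] assms
  by (simp add: qnbhd_def blinfun.diff_left blinfun.diff_right)

text \<open>The adjoint of the assumed identity: absorption on the right becomes absorption on the
  left.\<close>

lemma adjoint_absorb:
  assumes "adjoint_pair A A" "adjoint_pair B B" "adjoint_pair J Jd"
    and "\<And>x. A (Jd x) = A (Jd (blinfun_apply B x))"
  shows "J (A y) = B (J (A y))"
proof (rule cinner_ext_left)
  fix z
  show "cinner (J (A y)) z = cinner (B (J (A y))) z"
    using assms by (simp add: adjoint_pair_def)
qed

text \<open>The annihilation test is applied to \<open>id_blinfun - proj_Sup S\<close>.\<close>

lemma coverI:
  fixes S :: "('h :: chilbert_space \<Rightarrow>\<^sub>L 'h) set"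
  assumes "S \<subseteq> projections"
    and "\<And>T :: 'h \<Rightarrow>\<^sub>L 'h. (\<And>P x. P \<in> S \<Longrightarrow> blinfun_apply T (blinfun_apply P x) = 0) \<Longrightarrow> T = 0"
  shows "cover S"
proof -
  have "id_blinfun - proj_Sup S = 0"
    using assms(1) by (intro assms(2)) (simp add: blinfun.diff_left proj_Sup_absorbs)
  then show ?thesis by (simp add: cover_def)
qed

lemma coverD:
  fixes T :: "'h :: chilbert_space \<Rightarrow>\<^sub>L 'b :: real_normed_vector"
  assumes "cover S" "S \<subseteq> projections" "\<And>P x. P \<in> S \<Longrightarrow> T (P x) = 0"
  shows "T = 0"
  using zero_on_proj_Sup[OF assms(2), of T] assms(1,3)
  by (intro blinfun_eqI) (simp add: cover_def blinfun.zero_left)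

text \<open>The common setting of quotients and summands. \<open>V_corner\<close> makes distances
  monotone under compression; \<open>central\<close> lets members of \<open>M\<close> pass through
  \<open>J\<close> and \<open>Jd\<close>.\<close>

locale central_corner = corner J Jd
  for J :: "'k :: chilbert_space \<Rightarrow>\<^sub>L 'h :: chilbert_space" and Jd :: "'h \<Rightarrow>\<^sub>L 'k" +
  fixes M :: "('h \<Rightarrow>\<^sub>L 'h) set" and V :: "real \<Rightarrow> ('h \<Rightarrow>\<^sub>L 'h) set"
    and N :: "('k \<Rightarrow>\<^sub>L 'k) set" and W :: "real \<Rightarrow> ('k \<Rightarrow>\<^sub>L 'k) set"
  assumes N_eq: "N = down ` M" and W_eq: "0 \<le> t \<Longrightarrow> W t = down ` V t"
    and central: "A \<in> M \<Longrightarrow> A o\<^sub>L R = R o\<^sub>L A"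
    and M_corner: "A \<in> M \<Longrightarrow> up (down A) \<in> M"
    and V_corner: "0 \<le> t \<Longrightarrow> A \<in> V t \<Longrightarrow> up (down A) \<in> V t"
begin

sublocale amp: corner "ampl J" "ampl Jd"
  by (rule corner_ampl)

lemma ampl_down: "ampl (down A) = amp.down (ampl A)"
  by (simp add: down_def amp.down_def ampl_compose)

lemma ampl_up: "ampl (up A) = amp.up (ampl A)"
  by (simp add: up_def amp.up_def ampl_compose)

lemma ampl_R: "ampl R = amp.R"
  by (simp add: R_def amp.R_def ampl_compose)

lemma up_in_M: "B \<in> N \<Longrightarrow> up B \<in> M"
  using M_corner by (auto simp: N_eq)

lemma down_in_N: "A \<in> M \<Longrightarrow> down A \<in> N"
  by (simp add: N_eq)

lemma amp_central: "T \<in> tensor_B_ell2 M \<Longrightarrow> T o\<^sub>L amp.R = amp.R o\<^sub>L T"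
  using tensor_B_ell2_commutes[OF R_selfadjoint central] by (simp add: ampl_R)

lemma amp_down_in: "T \<in> tensor_B_ell2 M \<Longrightarrow> amp.down T \<in> tensor_B_ell2 N"
  unfolding amp.down_def
  by (rule tensor_B_ell2_conj[OF adjoint_pair_sym[OF adj]]) (simp_all add: down_in_N[unfolded down_def])

lemma amp_up_in: "T \<in> tensor_B_ell2 N \<Longrightarrow> amp.up T \<in> tensor_B_ell2 M"
  unfolding amp.up_def
  by (rule tensor_B_ell2_conj[OF adj]) (simp_all add: up_in_M[unfolded up_def])

text \<open>\<open>J\<close> is injective and \<open>Jd\<close> surjective, so a product over
  \<open>V t\<close> vanishes exactly when the compressed product does, and \<open>W t\<close>
  consists of the compressions.\<close>

lemma qdist_amp_up: "qdist_amp V (amp.up P) (amp.up Q) = qdist_amp W P Q"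
proof -
  have "amp.up P o\<^sub>L ampl A o\<^sub>L amp.up Q = amp.up (P o\<^sub>L ampl (down A) o\<^sub>L Q)" for A
    by (rule blinfun_eqI) (simp add: ampl_down)
  then have "amp.up P o\<^sub>L ampl A o\<^sub>L amp.up Q \<noteq> 0 \<longleftrightarrow> P o\<^sub>L ampl (down A) o\<^sub>L Q \<noteq> 0" for A
    by simp
  then have "{t. 0 \<le> t \<and> (\<exists>A\<in>V t. amp.up P o\<^sub>L ampl A o\<^sub>L amp.up Q \<noteq> 0)}
      = {t. 0 \<le> t \<and> (\<exists>B\<in>W t. P o\<^sub>L ampl B o\<^sub>L Q \<noteq> 0)}"
    using W_eq by auto
  then show ?thesis by (simp add: qdist_amp_def amplify_eq_ampl)
qed

text \<open>A witness \<open>A\<close> for the compressed pair yields the witness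
  \<open>R A R\<close> for \<open>P\<close> and \<open>Q\<close> at the same \<open>t\<close>; more
  admissible \<open>t\<close> can only lower the infimum.\<close>

lemma qdist_amp_le_down: "qdist_amp V P Q \<le> qdist_amp W (amp.down P) (amp.down Q)"
proof -
  have "P o\<^sub>L ampl (up (down A)) o\<^sub>L Q \<noteq> 0"
    if "amp.up (amp.down P) o\<^sub>L ampl A o\<^sub>L amp.up (amp.down Q) \<noteq> 0" for A
  proof
    assume zero: "P o\<^sub>L ampl (up (down A)) o\<^sub>L Q = 0"
    have "amp.up (amp.down P) o\<^sub>L ampl A o\<^sub>L amp.up (amp.down Q)
        = amp.R o\<^sub>L (P o\<^sub>L ampl (up (down A)) o\<^sub>L Q) o\<^sub>L amp.R"
      by (rule blinfun_eqI) (simp add: ampl_up ampl_down)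
    with that zero show False by simp
  qed
  then have "{t. 0 \<le> t \<and> (\<exists>A\<in>V t. amp.up (amp.down P) o\<^sub>L ampl A o\<^sub>L amp.up (amp.down Q) \<noteq> 0)}
      \<subseteq> {t. 0 \<le> t \<and> (\<exists>A\<in>V t. P o\<^sub>L ampl A o\<^sub>L Q \<noteq> 0)}"
    using V_corner by blast
  then have "qdist_amp V P Q \<le> qdist_amp V (amp.up (amp.down P)) (amp.up (amp.down Q))"
    unfolding qdist_amp_def amplify_eq_ampl by (rule INF_superset_mono) simp
  then show ?thesis by (simp only: qdist_amp_up)
qed

lemma qdist_up: "qdist V (up P) (up Q) = qdist W P Q"
  by (simp add: qdist_def amplify_eq_ampl ampl_up qdist_amp_up)

lemma qdist_le_down: "qdist V P Q \<le> qdist W (down P) (down Q)"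
  by (simp add: qdist_def amplify_eq_ampl ampl_down qdist_amp_le_down)

text \<open>Admissible pairs pass both ways: compression does not lower their distance, extension by
  zero preserves it. Compressed pairs remain admissible because amplified projections commute with
  \<open>R \<otimes> Id\<close>.\<close>

lemma qdiam_up: "qdiam M V (up P) = qdiam N W P"
proof (cases "P = 0")
  case True
  then show ?thesis by (simp add: qdiam_def)
next
  case False
  define SM where "SM = {(Q, Q'). Q \<in> projections \<inter> tensor_B_ell2 M \<and> Q' \<in> projections \<inter> tensor_B_ell2 M \<and>
    (\<exists>A\<in>clinear_ops. Q o\<^sub>L ampl (up P o\<^sub>L A o\<^sub>L up P) o\<^sub>L Q' \<noteq> 0)}"
  define SN where "SN = {(Q, Q'). Q \<in> projections \<inter> tensor_B_ell2 N \<and> Q' \<in> projections \<inter> tensor_B_ell2 N \<and>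
    (\<exists>A\<in>clinear_ops. Q o\<^sub>L ampl (P o\<^sub>L A o\<^sub>L P) o\<^sub>L Q' \<noteq> 0)}"
  have "(SUP (Q, Q')\<in>SM. qdist_amp V Q Q') = (SUP (Q, Q')\<in>SN. qdist_amp W Q Q')"
  proof (intro antisym SUP_least)
    fix z assume "z \<in> SM"
    then obtain Q Q' A where z: "z = (Q, Q')"
      and Q: "Q \<in> projections" "Q \<in> tensor_B_ell2 M" and Q': "Q' \<in> projections" "Q' \<in> tensor_B_ell2 M"
      and A: "A \<in> clinear_ops" "Q o\<^sub>L ampl (up P o\<^sub>L A o\<^sub>L up P) o\<^sub>L Q' \<noteq> 0"
      by (auto simp: SM_def)
    have "Q o\<^sub>L ampl (up P o\<^sub>L A o\<^sub>L up P) o\<^sub>L Q'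
        = amp.up (amp.down Q o\<^sub>L ampl (P o\<^sub>L down A o\<^sub>L P) o\<^sub>L amp.down Q')"
      by (rule blinfun_eqI)
        (simp add: ampl_compose ampl_up ampl_down amp.down_apply[of "ampl A"]
          amp.commutes_apply_J[OF amp_central[OF Q(2)]] amp.commutes_Jd_apply[OF amp_central[OF Q'(2)]]
          del: amp.down_apply)
    with A(2) have "amp.down Q o\<^sub>L ampl (P o\<^sub>L down A o\<^sub>L P) o\<^sub>L amp.down Q' \<noteq> 0" by auto
    with Q Q' A(1) have "(amp.down Q, amp.down Q') \<in> SN"
      by (auto simp: SN_def amp_down_in amp.down_projection amp_central intro: down_clinear)
    then have "qdist_amp W (amp.down Q) (amp.down Q') \<le> (SUP (Q, Q')\<in>SN. qdist_amp W Q Q')"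
      by (rule SUP_upper2) simp
    with qdist_amp_le_down[of Q Q'] show "(case z of (Q, Q') \<Rightarrow> qdist_amp V Q Q') \<le> (SUP (Q, Q')\<in>SN. qdist_amp W Q Q')"
      by (auto simp: z)
  next
    fix z assume "z \<in> SN"
    then obtain Q Q' A where z: "z = (Q, Q')"
      and Q: "Q \<in> projections" "Q \<in> tensor_B_ell2 N" and Q': "Q' \<in> projections" "Q' \<in> tensor_B_ell2 N"
      and A: "A \<in> clinear_ops" "Q o\<^sub>L ampl (P o\<^sub>L A o\<^sub>L P) o\<^sub>L Q' \<noteq> 0"
      by (auto simp: SN_def)
    have "amp.up Q o\<^sub>L ampl (up P o\<^sub>L up A o\<^sub>L up P) o\<^sub>L amp.up Q'
        = amp.up (Q o\<^sub>L ampl (P o\<^sub>L A o\<^sub>L P) o\<^sub>L Q')"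
      by (rule blinfun_eqI) (simp add: ampl_compose ampl_up)
    with A(2) have "amp.up Q o\<^sub>L ampl (up P o\<^sub>L up A o\<^sub>L up P) o\<^sub>L amp.up Q' \<noteq> 0" by simp
    with Q Q' A(1) have "(amp.up Q, amp.up Q') \<in> SM"
      by (auto simp: SM_def amp_up_in amp.up_projection intro: up_clinear)
    then have "qdist_amp V (amp.up Q) (amp.up Q') \<le> (SUP (Q, Q')\<in>SM. qdist_amp V Q Q')"
      by (rule SUP_upper2) simp
    then show "(case z of (Q, Q') \<Rightarrow> qdist_amp W Q Q') \<le> (SUP (Q, Q')\<in>SM. qdist_amp V Q Q')"
      by (simp add: z qdist_amp_up)
  qed
  with False show ?thesis by (simp add: qdiam_def amplify_eq_ampl SM_def SN_def)
qed

text \<open>By \<open>qdiam_up\<close> both diameters can be computed in \<open>M\<close>, where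
  \<open>up (down P)\<close> is \<open>P R\<close>. A witness \<open>A\<close> for
  \<open>P R\<close> gives the witness \<open>R A R\<close> for \<open>P\<close>, so fewer pairs
  compete.\<close>

lemma qdiam_down_le:
  assumes "P \<in> M"
  shows "qdiam N W (down P) \<le> qdiam M V P"
proof -
  have sw: "up (down P) o\<^sub>L A o\<^sub>L up (down P) = P o\<^sub>L up (down A) o\<^sub>L P" for A
    by (intro blinfun_eqI)
      (simp add: down_apply[of A] commutes_apply_J[OF central[OF assms]]
        commutes_Jd_apply[OF central[OF assms]] del: down_apply)
  show ?thesis
  \<comment> \<open>\<open>qdiam\<close> has a separate value at zero, and \<open>P R\<close> may
    vanish although \<open>P\<close> does not.\<close>
  proof (cases "up (down P) = 0")
    case True
    then show ?thesis unfolding qdiam_up[symmetric] by (simp add: qdiam_def)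
  next
    case False
    then have "P \<noteq> 0" by (auto simp: up_down)
    have "{(Q, Q'). Q \<in> projections \<inter> tensor_B_ell2 M \<and> Q' \<in> projections \<inter> tensor_B_ell2 M \<and>
        (\<exists>A\<in>clinear_ops. Q o\<^sub>L ampl (up (down P) o\<^sub>L A o\<^sub>L up (down P)) o\<^sub>L Q' \<noteq> 0)}
      \<subseteq> {(Q, Q'). Q \<in> projections \<inter> tensor_B_ell2 M \<and> Q' \<in> projections \<inter> tensor_B_ell2 M \<and>
        (\<exists>A\<in>clinear_ops. Q o\<^sub>L ampl (P o\<^sub>L A o\<^sub>L P) o\<^sub>L Q' \<noteq> 0)}"
      unfolding sw using up_clinear[OF down_clinear] by blast
    with False \<open>P \<noteq> 0\<close> show ?thesis
      unfolding qdiam_up[symmetric] unfolding qdiam_def amplify_eq_ampl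
      by (simp only: if_False) (rule SUP_subset_mono, simp_all)
  qed
qed

text \<open>If \<open>Q\<close> is far from \<open>P\<close>, then \<open>down Q\<close> is far from
  \<open>down P\<close>, and \<open>Jd\<close> intertwines the two. In this form the neighborhood of
  \<open>down P\<close> is dominated by that of \<open>P\<close>.\<close>

lemma qnbhd_down_absorb:
  "qnbhd N W r (down P) (Jd (qnbhd M V r P x)) = qnbhd N W r (down P) (Jd x)"
proof -
  have "(qnbhd N W r (down P) o\<^sub>L Jd) (qnbhd M V r P x) = (qnbhd N W r (down P) o\<^sub>L Jd) x"
  proof (rule absorb_qnbhd)
    fix Q y assume Q: "Q \<in> projections" "Q \<in> M" "ennreal r \<le> qdist V P Q"
    have "qnbhd N W r (down P) (down Q (Jd y)) = 0"
      using Q by (intro qnbhd_vanishes down_projection central down_in_N) (auto intro: order_trans qdist_le_down)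
    then show "(qnbhd N W r (down P) o\<^sub>L Jd) (Q y) = 0"
      by (simp add: commutes_Jd_apply[OF central[OF Q(2)]] del: down_apply)
  qed
  then show ?thesis by simp
qed

lemma r_disjoint_down:
  assumes "r_disjoint M V r \<P>"
  shows "r_disjoint N W r (down ` \<P>)"
  unfolding r_disjoint_def
proof (intro ballI impI)
  fix P' Q' assume "P' \<in> down ` \<P>" "Q' \<in> down ` \<P>" "P' \<noteq> Q'"
  then obtain P Q where PQ: "P' = down P" "Q' = down Q" "P \<in> \<P>" "Q \<in> \<P>" "P \<noteq> Q" by auto
  let ?A = "\<lambda>P. qnbhd N W r (down P)" and ?B = "qnbhd M V r"
  have B: "?B P (?B Q x) = 0" for x
    using assms PQ unfolding r_disjoint_def by (metis blinfun_apply_blinfun_compose blinfun.zero_left)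
  have "?A P (?A Q y) = 0" for y
  proof -
    \<comment> \<open>Absorption inserts \<open>?B P\<close> after the left factor, its adjoint form
      inserts \<open>?B Q\<close> before the right one; the two meet in a zero product.\<close>
    have "?A P (?A Q y) = ?A P (Jd (?B P (J (?A Q y))))"
      by (simp add: qnbhd_down_absorb)
    also have "J (?A Q y) = ?B Q (J (?A Q y))"
      by (rule adjoint_absorb[OF qnbhd_selfadjoint qnbhd_selfadjoint adj]) (simp add: qnbhd_down_absorb)
    finally show ?thesis by (simp add: B blinfun.zero_right)
  qed
  then show "qnbhd N W r P' o\<^sub>L qnbhd N W r Q' = 0"
    by (intro blinfun_eqI) (simp add: PQ blinfun.zero_left)
qed

lemma asdim_le_corner:
  assumes "asdim_le M V n"
  shows "asdim_le N W n"
  unfolding asdim_le_def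
proof (intro allI impI)
  fix r :: real assume "r > 0"
  with assms obtain \<P> where \<P>: "\<And>i. i \<le> n \<Longrightarrow> \<P> i \<subseteq> projections \<inter> M"
    "\<And>i. i \<le> n \<Longrightarrow> uniformly_bounded M V (\<P> i)" "\<And>i. i \<le> n \<Longrightarrow> r_disjoint M V r (\<P> i)"
    and cov: "cover (\<Union>i\<le>n. \<P> i)"
    unfolding asdim_le_def by metis
  have sub: "down ` \<P> i \<subseteq> projections \<inter> N" if "i \<le> n" for i
    using \<P>(1)[OF that] central by (auto intro: down_in_N down_projection)
  have "uniformly_bounded N W (down ` \<P> i)" if i: "i \<le> n" for i
  proof -
    obtain C where C: "C > 0" "(SUP P\<in>\<P> i. qdiam M V P) \<le> ennreal C"
      using \<P>(2)[OF i] unfolding uniformly_bounded_def by blast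
    have "(SUP P\<in>down ` \<P> i. qdiam N W P) \<le> (SUP P\<in>\<P> i. qdiam M V P)"
      unfolding image_image using \<P>(1)[OF i] by (intro SUP_mono) (auto intro: qdiam_down_le)
    with C show ?thesis unfolding uniformly_bounded_def by (meson order_trans)
  qed
  moreover have "cover (\<Union>i\<le>n. down ` \<P> i)"
  proof (rule coverI)
    show "(\<Union>i\<le>n. down ` \<P> i) \<subseteq> projections" using sub by blast
    fix T :: "'k \<Rightarrow>\<^sub>L 'k"
    assume T: "\<And>P x. P \<in> (\<Union>i\<le>n. down ` \<P> i) \<Longrightarrow> T (P x) = 0"
    \<comment> \<open>Since \<open>Jd\<close> intertwines \<open>P\<close> and
      \<open>down P\<close>, the composite \<open>T o\<^sub>L Jd\<close> kills the original
      cover.\<close>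
    have "T o\<^sub>L Jd = 0"
    proof (rule coverD[OF cov])
      show "(\<Union>i\<le>n. \<P> i) \<subseteq> projections" using \<P>(1) by blast
      fix P x assume "P \<in> (\<Union>i\<le>n. \<P> i)"
      then obtain i where i: "i \<le> n" "P \<in> \<P> i" by blast
      then have "T (down P (Jd x)) = 0" by (intro T) auto
      moreover have "P \<in> M" using \<P>(1) i by blast
      ultimately show "(T o\<^sub>L Jd) (P x) = 0" by (simp add: commutes_Jd_apply[OF central] del: down_apply)
    qed
    then have "(T o\<^sub>L Jd) (J x) = 0" for x by simp
    then show "T = 0" by (intro blinfun_eqI) simp
  qed
  ultimately show "\<exists>\<Q>. (\<forall>i\<le>n. \<Q> i \<subseteq> projections \<inter> N \<and> uniformly_bounded N W (\<Q> i) \<and> r_disjoint N W r (\<Q> i)) \<and>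
      cover (\<Union>i\<le>n. \<Q> i)"
    using sub r_disjoint_down \<P>(3) by (intro exI[of _ "\<lambda>i. down ` \<P> i"]) simp
qed

lemma asdim_corner: "asdim N W \<le> asdim M V"
  unfolding asdim_def using asdim_le_corner by (intro INF_superset_mono) auto

end

section \<open>Direct summands\<close>

text \<open>\<open>V_diagonal\<close> excludes entries leading from the complement into the corner,
  which a general central corner allows. \<open>complement\<close> admits the complementary
  projection to the supremum defining a neighborhood.\<close>

locale direct_summand = central_corner +
  assumes complement: "id_blinfun - R \<in> M"
    and V_diagonal: "0 \<le> t \<Longrightarrow> A \<in> V t \<Longrightarrow> Jd (A x) = Jd (A (J (Jd x)))"
begin

lemma complement_projection: "id_blinfun - R \<in> projections"
  using R_selfadjoint
  by (auto simp: projections_iff adjoint_pair_def blinfun.diff_left blinfun.diff_right cinner_diff_left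
      cinner_diff_right intro!: blinfun_eqI)

lemma qdist_complement: "qdist V (up P) (id_blinfun - R) = \<infinity>"
proof -
  have "ampl (up P) o\<^sub>L ampl A o\<^sub>L ampl (id_blinfun - R) = 0" if "0 \<le> t" "A \<in> V t" for t A
  proof -
    have "up P o\<^sub>L A o\<^sub>L (id_blinfun - R) = 0"
      using V_diagonal[OF that]
      by (intro blinfun_eqI) (simp add: blinfun.diff_left blinfun.diff_right blinfun.zero_left)
    then have "ampl (up P) o\<^sub>L ampl A o\<^sub>L ampl (id_blinfun - R) = ampl 0"
      by (simp only: ampl_compose[symmetric])
    also have "\<dots> = 0"
      by (intro blinfun_eqI ell2_eqI) (simp add: Rep_ampl blinfun.zero_left zero_ell2.rep_eq)
    finally show ?thesis .
  qed
  then have "{t. 0 \<le> t \<and> (\<exists>A\<in>V t. ampl (up P) o\<^sub>L ampl A o\<^sub>L ampl (id_blinfun - R) \<noteq> 0)} = {}"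
    by blast
  then show ?thesis by (simp add: qdist_def qdist_amp_def amplify_eq_ampl)
qed

text \<open>Infinite distance makes the neighborhood of \<open>up P\<close> vanish on the
  complement. On the corner, \<open>qdist_up\<close> turns projections of \<open>N\<close> far from
  \<open>P\<close> into projections of \<open>M\<close> far from \<open>up P\<close>.\<close>

lemma qnbhd_up_absorb:
  "qnbhd M V r (up P) (up (qnbhd N W r P) x) = qnbhd M V r (up P) x"
proof -
  let ?Z = "qnbhd M V r (up P)"
  have "?Z ((id_blinfun - R) x) = 0"
    by (intro qnbhd_vanishes complement_projection complement) (simp add: qdist_complement)
  then have "?Z x = (?Z o\<^sub>L J) (Jd x)"
    by (simp add: blinfun.diff_left blinfun.diff_right)
  also have "\<dots> = (?Z o\<^sub>L J) (qnbhd N W r P (Jd x))"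
  proof (rule absorb_qnbhd[symmetric])
    fix Q y assume Q: "Q \<in> projections" "Q \<in> N" "ennreal r \<le> qdist W P Q"
    have "?Z (up Q (J y)) = 0"
      using Q by (intro qnbhd_vanishes up_projection up_in_M) (simp_all add: qdist_up)
    then show "(?Z o\<^sub>L J) (Q y) = 0" by simp
  qed
  finally show ?thesis by simp
qed

lemma up_qnbhd_absorb:
  "up (qnbhd N W r P) (qnbhd M V r (up P) x) = qnbhd M V r (up P) x"
proof -
  have "adjoint_pair (id_blinfun :: 'b \<Rightarrow>\<^sub>L 'b) id_blinfun" by (simp add: adjoint_pair_def)
  then have "id_blinfun (qnbhd M V r (up P) x) = up (qnbhd N W r P) (id_blinfun (qnbhd M V r (up P) x))"
    by (rule adjoint_absorb[OF qnbhd_selfadjoint up_adjoint[OF qnbhd_selfadjoint]])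
      (simp only: blinfun_apply_id_blinfun qnbhd_up_absorb)
  then show ?thesis by simp
qed

lemma r_disjoint_up:
  assumes "r_disjoint N W r \<P>"
  shows "r_disjoint M V r (up ` \<P>)"
  unfolding r_disjoint_def
proof (intro ballI impI)
  fix P' Q' assume "P' \<in> up ` \<P>" "Q' \<in> up ` \<P>" "P' \<noteq> Q'"
  then obtain P Q where PQ: "P' = up P" "Q' = up Q" "P \<in> \<P>" "Q \<in> \<P>" "P \<noteq> Q" by auto
  have B: "qnbhd N W r P (qnbhd N W r Q x) = 0" for x
    using assms PQ unfolding r_disjoint_def by (metis blinfun_apply_blinfun_compose blinfun.zero_left)
  have "qnbhd M V r (up P) (qnbhd M V r (up Q) y) = 0" for y
  proof -
    \<comment> \<open>The extended neighborhoods from \<open>N\<close> are inserted in the middle,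
      where their product is the extension of zero.\<close>
    have "qnbhd M V r (up P) (qnbhd M V r (up Q) y)
        = qnbhd M V r (up P) (up (qnbhd N W r P) (up (qnbhd N W r Q) (qnbhd M V r (up Q) y)))"
      by (simp only: qnbhd_up_absorb up_qnbhd_absorb)
    then show ?thesis by (simp add: B blinfun.zero_right)
  qed
  then show "qnbhd M V r P' o\<^sub>L qnbhd M V r Q' = 0"
    by (intro blinfun_eqI) (simp add: PQ blinfun.zero_left)
qed

end


section \<open>Empty families and attained infima\<close>

lemma uniformly_bounded_empty [simp]: "uniformly_bounded M V {}"
  by (auto simp: uniformly_bounded_def bot_ennreal intro: exI[of _ 1])

lemma r_disjoint_empty [simp]: "r_disjoint M V r {}"
  by (simp add: r_disjoint_def)

lemma asdim_leI: "asdim_le M V n \<Longrightarrow> asdim M V \<le> enat n"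
  by (simp add: asdim_def INF_lower)

text \<open>An infimum of extended naturals is infinite on the empty set and attained
  otherwise.\<close>

lemma asdim_eq_enatD:
  assumes "asdim M V = enat n"
  shows "asdim_le M V n"
proof -
  have "enat ` {n. asdim_le M V n} \<noteq> {}"
    using assms by (auto simp: asdim_def Inf_enat_def split: if_splits)
  then have "asdim M V \<in> enat ` {n. asdim_le M V n}"
    unfolding asdim_def by (metis Inf_enat_def LeastI_ex ex_in_conv)
  then show ?thesis using assms by auto
qed

section \<open>Metric quotients as central corners\<close>

lemma isometry_cinner:
  fixes J :: "'k :: chilbert_space \<Rightarrow>\<^sub>L 'h :: chilbert_space"
  assumes "\<And>c x. J (c *\<^sub>C x) = c *\<^sub>C J x" "\<And>x. norm (J x) = norm x"
  shows "cinner (J x) (J y) = cinner x y"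
proof -
  have "inner (J x) (J y) = inner x y" for x y
    using assms(2)[of "x + y"] by (simp add: dot_norm blinfun.add_right assms(2))
  then show ?thesis by (metis cinner_eq_inner assms(1))
qed

text \<open>\<open>Jd\<close> is \<open>R\<close> followed by the inverse of \<open>J\<close> on the
  range of \<open>R\<close>. It is bounded since \<open>J\<close> is isometric, and adjoint to
  \<open>J\<close> since \<open>R\<close> is self-adjoint and fixes the range of
  \<open>J\<close>.\<close>

lemma unitary_onto_range_corner:
  fixes J :: "'k :: chilbert_space \<Rightarrow>\<^sub>L 'h :: chilbert_space"
  assumes J: "unitary_onto_range J R" and R: "R \<in> projections"
  obtains Jd where "corner J Jd" "J o\<^sub>L Jd = R"
proof -
  have C: "\<And>c x. J (c *\<^sub>C x) = c *\<^sub>C J x" and norm: "\<And>x. norm (J x) = norm x"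
    and range: "range (blinfun_apply J) = range (blinfun_apply R)"
    using J unfolding unitary_onto_range_def by blast+
  have inj: "x = y" if "J x = J y" for x y
    using norm[of "x - y"] that by (simp add: blinfun.diff_right)
  have "\<exists>y. J y = R x" for x using range by (metis rangeE rangeI)
  then obtain f where f: "\<And>x. J (f x) = R x" by metis
  have "bounded_linear f"
  proof (rule bounded_linear_intro[where K = "norm R"])
    show "f (x + y) = f x + f y" for x y by (rule inj) (simp add: f blinfun.add_right)
    show "f (r *\<^sub>R x) = r *\<^sub>R f x" for r x by (rule inj) (simp add: f blinfun.scaleR_right)
    show "norm (f x) \<le> norm x * norm R" for x
      using norm_blinfun[of R x] norm[of "f x"] by (simp add: f mult.commute)
  qed
  then have app: "blinfun_apply (Blinfun f) = f" by (rule bounded_linear_Blinfun_apply)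
  have RJ: "R (J x) = J x" for x
    by (rule projection_fixes_range[OF R]) (metis range rangeI)
  have "corner J (Blinfun f)"
  proof
    have "cinner (J x) y = cinner x (f y)" for x y
    proof -
      have "cinner (J x) y = cinner (J x) (R y)"
        using R RJ by (metis projections_iff adjoint_pairD)
      then show ?thesis by (simp add: f[symmetric] isometry_cinner[OF C norm])
    qed
    then show "adjoint_pair J (Blinfun f)" by (simp add: adjoint_pair_def app)
    show "Blinfun f (J x) = x" for x by (rule inj) (simp add: app f RJ)
  qed
  moreover have "J o\<^sub>L Blinfun f = R" by (rule blinfun_eqI) (simp add: app f)
  ultimately show ?thesis by (rule that)
qed

lemma (in corner) compressions_eq: "compressions R J S = down ` S"
proof (intro set_eqI iffI)
  fix B assume "B \<in> compressions R J S"
  then obtain A where A: "A \<in> S" "\<And>x. J (B x) = (R o\<^sub>L A o\<^sub>L R) (J x)"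
    unfolding compressions_def by blast
  have "B x = down A x" for x using A(2)[of x] Jd_J by (metis down_apply up_apply up_down)
  then have "B = down A" by (rule blinfun_eqI)
  with A(1) show "B \<in> down ` S" by simp
qed (auto simp: compressions_def)

lemma metric_quotient_asdim_le:
  assumes MV: "quantum_metric_space M V" and q: "metric_quotient N W M V"
  shows "asdim N W \<le> asdim M V"
proof -
  obtain R J where R: "R \<in> projections" "R \<in> M" "R \<in> commutant M" and J: "unitary_onto_range J R"
    and N: "N = compressions R J M" and W: "\<And>t. 0 \<le> t \<Longrightarrow> W t = compressions R J (V t)"
    using q unfolding metric_quotient_def by blast
  obtain Jd where c: "corner J Jd" and JJd: "J o\<^sub>L Jd = R"
    using unitary_onto_range_corner[OF J R(1)] .
  interpret corner J Jd by (rule c)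
  have Req: "corner.R J Jd = R" by (simp add: R_def JJd)
  have mult: "A o\<^sub>L B \<in> M" if "A \<in> M" "B \<in> M" for A B
    using MV that by (simp add: quantum_metric_space_def von_neumann_algebra_def)
  have multV: "A o\<^sub>L B \<in> V (s + t)" if "0 \<le> s" "0 \<le> t" "A \<in> V s" "B \<in> V t" for A B s t
    using MV that unfolding quantum_metric_space_def quantum_metric_def by blast
  \<comment> \<open>Centrality places \<open>R\<close> in the commutant \<open>V 0\<close>, so
    \<open>R A R\<close> stays at level \<open>0 + t + 0\<close>.\<close>
  have RV: "R \<in> V 0"
    using MV R(3) unfolding quantum_metric_space_def quantum_metric_def by blast
  interpret central_corner J Jd M V N W
  proof
    show "N = down ` M" using N compressions_eq by (simp add: Req)
    show "W t = down ` V t" if "0 \<le> t" for t using W[OF that] compressions_eq by (simp add: Req)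
    show "A o\<^sub>L corner.R J Jd = corner.R J Jd o\<^sub>L A" if "A \<in> M" for A
      using R(3) that by (simp add: Req commutant_def)
    show "up (down A) \<in> M" if "A \<in> M" for A
      using mult R(2) that by (simp add: up_down Req)
    show "up (down A) \<in> V t" if "0 \<le> t" "A \<in> V t" for t A
      using multV[OF that(1) order_refl multV[OF order_refl that(1) RV that(2), simplified] RV]
      by (simp add: up_down Req)
  qed
  show ?thesis by (rule asdim_corner)
qed

section \<open>The two summands of a direct sum\<close>

lift_definition inl_blinfun :: "'a :: real_normed_vector \<Rightarrow>\<^sub>L ('a \<times> 'b :: real_normed_vector)"
  is "\<lambda>x. (x, 0)"
  by (intro bounded_linear_Pair bounded_linear_ident bounded_linear_zero)

lift_definition inr_blinfun :: "'b :: real_normed_vector \<Rightarrow>\<^sub>L ('a :: real_normed_vector \<times> 'b)"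
  is "\<lambda>x. (0, x)"
  by (intro bounded_linear_Pair bounded_linear_ident bounded_linear_zero)

declare inl_blinfun.rep_eq [simp] inr_blinfun.rep_eq [simp] op_sum.rep_eq [simp]

interpretation inl: corner inl_blinfun fst_blinfun
  by standard (simp_all add: adjoint_pair_def cinner_prod_def)

interpretation inr: corner inr_blinfun snd_blinfun
  by standard (simp_all add: adjoint_pair_def cinner_prod_def)

lemma inl_down_op_sum [simp]: "inl.down (op_sum A B) = A"
  by (rule blinfun_eqI) simp

lemma inr_down_op_sum [simp]: "inr.down (op_sum A B) = B"
  by (rule blinfun_eqI) simp

lemma inl_up_eq: "inl.up A = op_sum A 0"
  by (rule blinfun_eqI) simp

lemma inr_up_eq: "inr.up B = op_sum 0 B"
  by (rule blinfun_eqI) simp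

lemma inl_complement: "id_blinfun - inl.R = op_sum 0 id_blinfun"
  by (rule blinfun_eqI) (simp add: blinfun.diff_left prod_eq_iff)

lemma inr_complement: "id_blinfun - inr.R = op_sum id_blinfun 0"
  by (rule blinfun_eqI) (simp add: blinfun.diff_left prod_eq_iff)

lemma in_direct_sum [simp]: "op_sum A B \<in> direct_sum S T \<longleftrightarrow> A \<in> S \<and> B \<in> T"
  unfolding direct_sum_def by (auto; metis inl_down_op_sum inr_down_op_sum)

lemma in_direct_sumE:
  assumes "X \<in> direct_sum S T"
  obtains A B where "X = op_sum A B" "A \<in> S" "B \<in> T"
  using assms unfolding direct_sum_def by blast

lemma inl_down_direct_sum: "0 \<in> T \<Longrightarrow> inl.down ` direct_sum S T = S"
  by (auto simp: image_iff elim!: in_direct_sumE) (metis in_direct_sum inl_down_op_sum)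

lemma inr_down_direct_sum: "0 \<in> S \<Longrightarrow> inr.down ` direct_sum S T = T"
  by (auto simp: image_iff elim!: in_direct_sumE) (metis in_direct_sum inr_down_op_sum)

lemma quantum_metric_space_members:
  assumes "quantum_metric_space M V"
  shows "0 \<in> M" "id_blinfun \<in> M" "0 \<le> t \<Longrightarrow> 0 \<in> V t"
proof -
  have M: "von_neumann_algebra M" and V: "\<And>t. 0 \<le> t \<Longrightarrow> op_csubspace (V t)"
    using assms unfolding quantum_metric_space_def quantum_metric_def by blast+
  show "0 \<in> M" "id_blinfun \<in> M"
    using M by (simp_all add: von_neumann_algebra_def op_csubspace_def subspace_0)
  show "0 \<in> V t" if "0 \<le> t"
    using V[OF that] by (simp add: op_csubspace_def subspace_0)
qed

context
  fixes M :: "('h :: chilbert_space \<Rightarrow>\<^sub>L 'h) set" and V :: "real \<Rightarrow> ('h \<Rightarrow>\<^sub>L 'h) set"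
    and N :: "('k :: chilbert_space \<Rightarrow>\<^sub>L 'k) set" and W :: "real \<Rightarrow> ('k \<Rightarrow>\<^sub>L 'k) set"
  assumes MV: "quantum_metric_space M V" and NW: "quantum_metric_space N W"
begin

text \<open>Compressions stay inside since \<open>0\<close> belongs to \<open>N\<close> and to every
  \<open>W t\<close>; the complement \<open>op_sum 0 id_blinfun\<close> belongs to the sum since
  \<open>N\<close> is unital.\<close>

interpretation left: direct_summand inl_blinfun fst_blinfun "direct_sum M N"
  "\<lambda>t. direct_sum (V t) (W t)" M V
  using quantum_metric_space_members[OF MV] quantum_metric_space_members[OF NW]
  by unfold_locales
    (auto simp: inl_down_direct_sum inl_up_eq inl_complement blinfun.zero_left blinfun.zero_right
      intro!: blinfun_eqI elim!: in_direct_sumE)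

interpretation right: direct_summand inr_blinfun snd_blinfun "direct_sum M N"
  "\<lambda>t. direct_sum (V t) (W t)" N W
  using quantum_metric_space_members[OF MV] quantum_metric_space_members[OF NW]
  by unfold_locales
    (auto simp: inr_down_direct_sum inr_up_eq inr_complement blinfun.zero_left blinfun.zero_right
      intro!: blinfun_eqI elim!: in_direct_sumE)

text \<open>Absorption inserts operators supported on different summands, whose product is zero. The
  reverse order follows separately, as disjointness ranges over ordered pairs.\<close>

lemma qnbhd_left_right:
  "qnbhd (direct_sum M N) (\<lambda>t. direct_sum (V t) (W t)) r (inl.up P) o\<^sub>L
    qnbhd (direct_sum M N) (\<lambda>t. direct_sum (V t) (W t)) r (inr.up Q) = 0" (is "?Z o\<^sub>L ?Z' = 0")
proof (rule blinfun_eqI)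
  fix x
  have "?Z (?Z' x) = ?Z (inl.up (qnbhd M V r P) (inr.up (qnbhd N W r Q) (?Z' x)))"
    by (simp only: left.qnbhd_up_absorb right.up_qnbhd_absorb)
  then show "(?Z o\<^sub>L ?Z') x = blinfun_apply 0 x"
    by (simp add: blinfun.zero_right blinfun.zero_left zero_prod_def[symmetric])
qed

lemma qnbhd_right_left:
  "qnbhd (direct_sum M N) (\<lambda>t. direct_sum (V t) (W t)) r (inr.up Q) o\<^sub>L
    qnbhd (direct_sum M N) (\<lambda>t. direct_sum (V t) (W t)) r (inl.up P) = 0" (is "?Z o\<^sub>L ?Z' = 0")
proof (rule blinfun_eqI)
  fix x
  have "?Z (?Z' x) = ?Z (inr.up (qnbhd N W r Q) (inl.up (qnbhd M V r P) (?Z' x)))"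
    by (simp only: right.qnbhd_up_absorb left.up_qnbhd_absorb)
  then show "(?Z o\<^sub>L ?Z') x = blinfun_apply 0 x"
    by (simp add: blinfun.zero_right blinfun.zero_left zero_prod_def[symmetric])
qed

lemma r_disjoint_Un:
  assumes "r_disjoint M V r \<P>" "r_disjoint N W r \<Q>"
  shows "r_disjoint (direct_sum M N) (\<lambda>t. direct_sum (V t) (W t)) r (inl.up ` \<P> \<union> inr.up ` \<Q>)"
  using left.r_disjoint_up[OF assms(1)] right.r_disjoint_up[OF assms(2)] qnbhd_left_right qnbhd_right_left
  unfolding r_disjoint_def by blast

lemma uniformly_bounded_Un:
  assumes "uniformly_bounded M V \<P>" "uniformly_bounded N W \<Q>"
  shows "uniformly_bounded (direct_sum M N) (\<lambda>t. direct_sum (V t) (W t)) (inl.up ` \<P> \<union> inr.up ` \<Q>)"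
proof -
  obtain B C where "B > 0" "(SUP P\<in>\<P>. qdiam M V P) \<le> ennreal B"
    "C > 0" "(SUP P\<in>\<Q>. qdiam N W P) \<le> ennreal C"
    using assms unfolding uniformly_bounded_def by blast
  then have "max B C > 0" "(SUP P\<in>\<P>. qdiam M V P) \<le> ennreal (max B C)"
    "(SUP P\<in>\<Q>. qdiam N W P) \<le> ennreal (max B C)"
    by (auto intro: order_trans ennreal_leI)
  then show ?thesis
    unfolding uniformly_bounded_def SUP_union image_image left.qdiam_up right.qdiam_up by (metis le_sup_iff)
qed

lemma asdim_le_direct_sum:
  assumes "asdim_le M V n" "asdim_le N W m"
  shows "asdim_le (direct_sum M N) (\<lambda>t. direct_sum (V t) (W t)) (max n m)"
  unfolding asdim_le_def
proof (intro allI impI)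
  fix r :: real assume r: "r > 0"
  obtain \<P> where \<P>: "\<And>i. i \<le> n \<Longrightarrow> \<P> i \<subseteq> projections \<inter> M"
    "\<And>i. i \<le> n \<Longrightarrow> uniformly_bounded M V (\<P> i)" "\<And>i. i \<le> n \<Longrightarrow> r_disjoint M V r (\<P> i)"
    and covP: "cover (\<Union>i\<le>n. \<P> i)"
    using assms(1) r unfolding asdim_le_def by metis
  obtain \<Q> where \<Q>: "\<And>i. i \<le> m \<Longrightarrow> \<Q> i \<subseteq> projections \<inter> N"
    "\<And>i. i \<le> m \<Longrightarrow> uniformly_bounded N W (\<Q> i)" "\<And>i. i \<le> m \<Longrightarrow> r_disjoint N W r (\<Q> i)"
    and covQ: "cover (\<Union>i\<le>m. \<Q> i)"
    using assms(2) r unfolding asdim_le_def by metis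
  \<comment> \<open>The shorter list of families is padded with empty ones, which are bounded and
    disjoint at every scale.\<close>
  define \<P>' where "\<P>' i = (if i \<le> n then \<P> i else {})" for i
  define \<Q>' where "\<Q>' i = (if i \<le> m then \<Q> i else {})" for i
  define \<R> where "\<R> i = inl.up ` \<P>' i \<union> inr.up ` \<Q>' i" for i
  have sub: "\<R> i \<subseteq> projections \<inter> direct_sum M N" for i
  proof -
    have "\<P>' i \<subseteq> projections \<inter> M" "\<Q>' i \<subseteq> projections \<inter> N"
      using \<P>(1)[of i] \<Q>(1)[of i] by (simp_all add: \<P>'_def \<Q>'_def)
    then show ?thesis
      unfolding \<R>_def using inl.up_projection inr.up_projection left.up_in_M right.up_in_M by blast
  qed
  have "r_disjoint (direct_sum M N) (\<lambda>t. direct_sum (V t) (W t)) r (\<R> i)" for i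
    unfolding \<R>_def using \<P>(3) \<Q>(3) by (intro r_disjoint_Un) (simp_all add: \<P>'_def \<Q>'_def)
  moreover have "uniformly_bounded (direct_sum M N) (\<lambda>t. direct_sum (V t) (W t)) (\<R> i)" for i
    unfolding \<R>_def using \<P>(2) \<Q>(2) by (intro uniformly_bounded_Un) (simp_all add: \<P>'_def \<Q>'_def)
  moreover have "cover (\<Union>i\<le>max n m. \<R> i)"
  proof (rule coverI)
    show "(\<Union>i\<le>max n m. \<R> i) \<subseteq> projections" using sub by blast
    fix T :: "('h \<times> 'k) \<Rightarrow>\<^sub>L ('h \<times> 'k)"
    assume T: "\<And>P x. P \<in> (\<Union>i\<le>max n m. \<R> i) \<Longrightarrow> T (P x) = 0"
    have l: "T o\<^sub>L inl_blinfun = 0"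
    proof (rule coverD[OF covP])
      show "(\<Union>i\<le>n. \<P> i) \<subseteq> projections" using \<P>(1) by blast
      fix P x assume "P \<in> (\<Union>i\<le>n. \<P> i)"
      then have "inl.up P \<in> (\<Union>i\<le>max n m. \<R> i)" by (force simp: \<R>_def \<P>'_def)
      from T[OF this, of "(x, 0)"] show "(T o\<^sub>L inl_blinfun) (P x) = 0" by simp
    qed
    have r: "T o\<^sub>L inr_blinfun = 0"
    proof (rule coverD[OF covQ])
      show "(\<Union>i\<le>m. \<Q> i) \<subseteq> projections" using \<Q>(1) by blast
      fix P x assume "P \<in> (\<Union>i\<le>m. \<Q> i)"
      then have "inr.up P \<in> (\<Union>i\<le>max n m. \<R> i)" by (force simp: \<R>_def \<Q>'_def)
      from T[OF this, of "(0, x)"] show "(T o\<^sub>L inr_blinfun) (P x) = 0" by simp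
    qed
    show "T = 0"
    proof (rule blinfun_eqI)
      fix x
      have "T x = (T o\<^sub>L inl_blinfun) (fst x) + (T o\<^sub>L inr_blinfun) (snd x)"
        by (simp add: blinfun.add_right[symmetric])
      then show "T x = blinfun_apply 0 x" by (simp only: l r blinfun.zero_left add_0)
    qed
  qed
  ultimately show "\<exists>\<R>. (\<forall>i\<le>max n m. \<R> i \<subseteq> projections \<inter> direct_sum M N \<and>
      uniformly_bounded (direct_sum M N) (\<lambda>t. direct_sum (V t) (W t)) (\<R> i) \<and>
      r_disjoint (direct_sum M N) (\<lambda>t. direct_sum (V t) (W t)) r (\<R> i)) \<and> cover (\<Union>i\<le>max n m. \<R> i)"
    using sub by blast
qed

lemma asdim_direct_sum:
  "asdim (direct_sum M N) (\<lambda>t. direct_sum (V t) (W t)) = max (asdim M V) (asdim N W)"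
proof (rule antisym)
  show "asdim (direct_sum M N) (\<lambda>t. direct_sum (V t) (W t)) \<le> max (asdim M V) (asdim N W)"
  proof (cases "asdim M V = \<infinity> \<or> asdim N W = \<infinity>")
    case False
    then obtain n m where nm: "asdim M V = enat n" "asdim N W = enat m" by auto
    then have "asdim_le (direct_sum M N) (\<lambda>t. direct_sum (V t) (W t)) (max n m)"
      by (intro asdim_le_direct_sum asdim_eq_enatD)
    from asdim_leI[OF this] show ?thesis by (simp add: nm max_def split: if_splits)
  qed auto
  show "max (asdim M V) (asdim N W) \<le> asdim (direct_sum M N) (\<lambda>t. direct_sum (V t) (W t))"
    using left.asdim_corner right.asdim_corner by simp
qed

end

theorem corollary4p7:
  fixes M :: "('h :: chilbert_space \<Rightarrow>\<^sub>L 'h) set" and V :: "real \<Rightarrow> ('h \<Rightarrow>\<^sub>L 'h) set"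
    and N :: "('k :: chilbert_space \<Rightarrow>\<^sub>L 'k) set" and W :: "real \<Rightarrow> ('k \<Rightarrow>\<^sub>L 'k) set"
  assumes "quantum_metric_space M V" and "quantum_metric_space N W"
  shows "(metric_quotient N W M V \<longrightarrow> asdim N W \<le> asdim M V) \<and>
    asdim (direct_sum M N) (\<lambda>t. direct_sum (V t) (W t)) = max (asdim M V) (asdim N W)"
  using metric_quotient_asdim_le asdim_direct_sum assms by blast

end
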